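(* Let $\gamma\in\Gamma$ be an element of finite order and let $|\gamma|$ denote its order. Then, as $N\to\infty$, $$\mathbb{E}\left[\mathrm{fix}_\gamma(N)\right]=N^{1/|\gamma|}+O\left(N^{1/(2|\gamma|)}\right).$$
   Context: Setting: $\Gamma=G_1*\dots*G_k$ with $k\ge 1$, where each $G_i$ is either a finite group, a finitely generated free group, or the fundamental group $\Lambda_g=\langle a_1,b_1,\dots,a_g,b_g\mid [a_1,b_1]\cdots[a_g,b_g]\rangle$ of a closed orientable surface of genus $g\ge 2$. For $\gamma\in\Gamma$ and a positive integer $N$, $\mathrm{fix}_\gamma(N)$ is the random variable counting the fixed points in $\{1,\dots,N\}$ of the permutation $\varphi(\gamma)\in S_N$, where $\varphi$ is uniformly random in the finite set $\mathrm{Hom}(\Gamma,S_N)$ of group homomorphisms. $\mathbb{E}$ is expectation with respect to $\varphi$; $\Gamma$ and $\gamma$ are fixed (so implied constants may depend on them). *)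

theory Defs
  imports
    "HOL-Algebra.Sym_Groups"
    "HOL-Algebra.Multiplicative_Group"
    "HOL-Probability.Probability_Mass_Function"
    "HOL-Library.Landau_Symbols"
begin

section \<open>Monoids and groups given by generators and relations\<close>

text \<open>
  The smallest congruence on the free monoid \<^term>\<open>lists A\<close> that identifies the two
  sides of every relation in \<^term>\<open>R\<close>. Only pairs of words over \<^term>\<open>A\<close> are related.
\<close>

inductive_set word_cong :: "'l set \<Rightarrow> ('l list \<times> 'l list) set \<Rightarrow> ('l list \<times> 'l list) set"
  for A :: "'l set" and R :: "('l list \<times> 'l list) set"
where
  rel: "(l, r) \<in> R \<Longrightarrow> l \<in> lists A \<Longrightarrow> r \<in> lists A \<Longrightarrow> u \<in> lists A \<Longrightarrow> v \<in> lists A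
        \<Longrightarrow> (u @ l @ v, u @ r @ v) \<in> word_cong A R"
| refl: "w \<in> lists A \<Longrightarrow> (w, w) \<in> word_cong A R"
| sym: "(w, w') \<in> word_cong A R \<Longrightarrow> (w', w) \<in> word_cong A R"
| trans: "(w, w') \<in> word_cong A R \<Longrightarrow> (w', w'') \<in> word_cong A R \<Longrightarrow> (w, w'') \<in> word_cong A R"

definition presented_monoid :: "'l set \<Rightarrow> ('l list \<times> 'l list) set \<Rightarrow> 'l list set monoid" where
  "presented_monoid A R =
     \<lparr> carrier = lists A // word_cong A R,
       mult = (\<lambda>X Y. \<Union>u\<in>X. \<Union>v\<in>Y. word_cong A R `` {u @ v}),
       one = word_cong A R `` {[]} \<rparr>"

text \<open>
  In words over \<^term>\<open>S \<times> (UNIV :: bool set)\<close> the letter \<^term>\<open>(s, True)\<close> stands for the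
  generator \<^term>\<open>s\<close> and \<^term>\<open>(s, False)\<close> for its inverse.
\<close>

definition presented_group ::
    "'g set \<Rightarrow> ('g \<times> bool) list set \<Rightarrow> ('g \<times> bool) list set monoid" where
  "presented_group S R =
     presented_monoid (S \<times> UNIV)
       ({([(s, b), (s, \<not> b)], []) | s b. s \<in> S} \<union> {(r, []) | r. r \<in> R})"

definition free_group :: "'g set \<Rightarrow> ('g \<times> bool) list set monoid" where
  "free_group S = presented_group S {}"


section \<open>Surface groups\<close>

datatype surface_gen = Gen_a nat | Gen_b nat

definition surface_relator :: "nat \<Rightarrow> (surface_gen \<times> bool) list" where
  "surface_relator g =
     concat (map (\<lambda>i. [(Gen_a i, True), (Gen_b i, True), (Gen_a i, False), (Gen_b i, False)])
                 [1..<Suc g])"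

definition surface_group :: "nat \<Rightarrow> (surface_gen \<times> bool) list set monoid" where
  "surface_group g = presented_group (Gen_a ` {1..g} \<union> Gen_b ` {1..g}) {surface_relator g}"


section \<open>Free products\<close>

text \<open>
  Words in the disjoint union of the carriers, modulo multiplying adjacent letters of the
  same factor and deleting the identities of the factors.
\<close>

definition free_product :: "'i set \<Rightarrow> ('i \<Rightarrow> 'a monoid) \<Rightarrow> ('i \<times> 'a) list set monoid" where
  "free_product I G =
     presented_monoid (SIGMA i:I. carrier (G i))
       ({([(i, x), (i, y)], [(i, x \<otimes>\<^bsub>G i\<^esub> y)]) | i x y.
            i \<in> I \<and> x \<in> carrier (G i) \<and> y \<in> carrier (G i)}
        \<union> {([(i, \<one>\<^bsub>G i\<^esub>)], []) | i. i \<in> I})"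

definition admissible_factor :: "'a monoid \<Rightarrow> bool" where
  "admissible_factor H \<longleftrightarrow>
     group H \<and>
     (finite (carrier H)
      \<or> (\<exists>n::nat. H \<cong> free_group {1..n})
      \<or> (\<exists>g\<ge>2. H \<cong> surface_group g))"


section \<open>Random permutation representations\<close>

text \<open>
  Elements of \<^term>\<open>hom \<Gamma> (sym_group N)\<close> are unconstrained outside the carrier of
  \<^term>\<open>\<Gamma>\<close>; the intersection with \<^const>\<open>extensional\<close> leaves one function per
  homomorphism.
\<close>

definition perm_reps :: "'a monoid \<Rightarrow> nat \<Rightarrow> ('a \<Rightarrow> nat \<Rightarrow> nat) set" where
  "perm_reps \<Gamma> N = hom \<Gamma> (sym_group N) \<inter> extensional (carrier \<Gamma>)"

definition fix_count :: "'a \<Rightarrow> nat \<Rightarrow> ('a \<Rightarrow> nat \<Rightarrow> nat) \<Rightarrow> nat" where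
  "fix_count \<gamma> N \<phi> = card {x \<in> {1..N}. \<phi> \<gamma> x = x}"

definition expected_fix :: "'a monoid \<Rightarrow> 'a \<Rightarrow> nat \<Rightarrow> real" where
  "expected_fix \<Gamma> \<gamma> N =
     measure_pmf.expectation (pmf_of_set (perm_reps \<Gamma> N)) (\<lambda>\<phi>. real (fix_count \<gamma> N \<phi>))"


section \<open>Presented structures are monoids and groups\<close>

lemma word_cong_lists:
  "(w, w') \<in> word_cong A R \<Longrightarrow> w \<in> lists A \<and> w' \<in> lists A"
  by (induction rule: word_cong.induct) auto

lemma equiv_word_cong: "equiv (lists A) (word_cong A R)"
proof (rule equivI)
  show "refl_on (lists A) (word_cong A R)"
    by (auto intro!: refl_onI word_cong.refl)
  show "sym (word_cong A R)"
    by (rule symI) (rule word_cong.sym)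
  show "trans (word_cong A R)"
    by (rule transI) (rule word_cong.trans)
  show "word_cong A R \<subseteq> lists A \<times> lists A"
    by (rule subrelI) (simp only: mem_Sigma_iff word_cong_lists)
qed

lemma word_cong_context:
  assumes "(w, w') \<in> word_cong A R" "p \<in> lists A" "q \<in> lists A"
  shows "(p @ w @ q, p @ w' @ q) \<in> word_cong A R"
  using assms
proof (induction rule: word_cong.induct)
  case (rel l r u v)
  then have "((p @ u) @ l @ (v @ q), (p @ u) @ r @ (v @ q)) \<in> word_cong A R"
    by (intro word_cong.rel) auto
  then show ?case by simp
next
  case (refl w)
  then show ?case by (intro word_cong.refl) auto
next
  case (sym w w')
  show ?case by (rule word_cong.sym) (use sym in blast)
next
  case (trans w w' w'')
  show ?case by (rule word_cong.trans[of _ "p @ w' @ q"]) (use trans in blast)+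
qed

lemma word_cong_append:
  assumes "(u, u') \<in> word_cong A R" "(v, v') \<in> word_cong A R"
  shows "(u @ v, u' @ v') \<in> word_cong A R"
proof -
  have "(u @ v, u' @ v) \<in> word_cong A R"
    using word_cong_context[OF assms(1), of "[]" v] word_cong_lists[OF assms(2)] by simp
  moreover have "(u' @ v, u' @ v') \<in> word_cong A R"
    using word_cong_context[OF assms(2), of u' "[]"] word_cong_lists[OF assms(1)] by simp
  ultimately show ?thesis by (rule word_cong.trans)
qed

lemma presented_monoid_carrierE:
  assumes "X \<in> carrier (presented_monoid A R)"
  obtains w where "w \<in> lists A" "X = word_cong A R `` {w}"
  using assms by (auto simp: presented_monoid_def elim!: quotientE)

lemma presented_monoid_class_in_carrier:
  "w \<in> lists A \<Longrightarrow> word_cong A R `` {w} \<in> carrier (presented_monoid A R)"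
  by (auto simp: presented_monoid_def intro: quotientI)

lemma presented_monoid_class_eq:
  "(u, v) \<in> word_cong A R \<Longrightarrow> word_cong A R `` {u} = word_cong A R `` {v}"
  by (rule equiv_class_eq[OF equiv_word_cong])

lemma presented_monoid_mult:
  assumes "u \<in> lists A" "v \<in> lists A"
  shows "word_cong A R `` {u} \<otimes>\<^bsub>presented_monoid A R\<^esub> word_cong A R `` {v}
         = word_cong A R `` {u @ v}"
proof -
  have "word_cong A R `` {u' @ v'} = word_cong A R `` {u @ v}"
    if "u' \<in> word_cong A R `` {u}" "v' \<in> word_cong A R `` {v}" for u' v'
    using presented_monoid_class_eq[OF word_cong_append] that by blast
  then have "(\<Union>u'\<in>word_cong A R `` {u}. \<Union>v'\<in>word_cong A R `` {v}. word_cong A R `` {u' @ v'})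
      = (\<Union>u'\<in>word_cong A R `` {u}. \<Union>v'\<in>word_cong A R `` {v}. word_cong A R `` {u @ v})"
    by (intro SUP_cong) simp_all
  also have "\<dots> = word_cong A R `` {u @ v}"
    using word_cong.refl[OF assms(1)] word_cong.refl[OF assms(2)] by blast
  finally show ?thesis by (simp add: presented_monoid_def)
qed

lemma presented_monoid_one: "\<one>\<^bsub>presented_monoid A R\<^esub> = word_cong A R `` {[]}"
  by (simp add: presented_monoid_def)

lemma monoid_presented_monoid: "Group.monoid (presented_monoid A R)"
proof (rule Group.monoidI)
  let ?M = "presented_monoid A R"
  fix X Y assume "X \<in> carrier ?M" "Y \<in> carrier ?M"
  then obtain u v where uv: "u \<in> lists A" "v \<in> lists A"
    and X: "X = word_cong A R `` {u}" and Y: "Y = word_cong A R `` {v}"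
    by (metis presented_monoid_carrierE)
  have "u @ v \<in> lists A" using uv by simp
  then show "X \<otimes>\<^bsub>?M\<^esub> Y \<in> carrier ?M"
    unfolding X Y presented_monoid_mult[OF uv] by (rule presented_monoid_class_in_carrier)
  fix Z assume "Z \<in> carrier ?M"
  then obtain w where w: "w \<in> lists A" and Z: "Z = word_cong A R `` {w}"
    by (rule presented_monoid_carrierE)
  have "u @ v \<in> lists A" "v @ w \<in> lists A" using uv w by simp_all
  then show "X \<otimes>\<^bsub>?M\<^esub> Y \<otimes>\<^bsub>?M\<^esub> Z = X \<otimes>\<^bsub>?M\<^esub> (Y \<otimes>\<^bsub>?M\<^esub> Z)"
    unfolding X Y Z by (simp only: presented_monoid_mult uv w append_assoc)
next
  let ?M = "presented_monoid A R"
  have Nil: "[] \<in> lists A" by simp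
  then show "\<one>\<^bsub>?M\<^esub> \<in> carrier ?M"
    unfolding presented_monoid_one by (rule presented_monoid_class_in_carrier)
  fix X assume "X \<in> carrier ?M"
  then obtain u where u: "u \<in> lists A" and X: "X = word_cong A R `` {u}"
    by (rule presented_monoid_carrierE)
  show "\<one>\<^bsub>?M\<^esub> \<otimes>\<^bsub>?M\<^esub> X = X" "X \<otimes>\<^bsub>?M\<^esub> \<one>\<^bsub>?M\<^esub> = X"
    unfolding X presented_monoid_one using u Nil
    by (simp_all only: presented_monoid_mult append_Nil append_Nil2)
qed

text \<open>If every letter has a left inverse up to the relations, then so has every word.\<close>

lemma group_presented_monoid:
  assumes inv: "\<And>a. a \<in> A \<Longrightarrow> \<exists>w \<in> lists A. (w @ [a], []) \<in> word_cong A R"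
  shows "group (presented_monoid A R)"
proof -
  have word_inv: "\<exists>w' \<in> lists A. (w' @ w, []) \<in> word_cong A R" if "w \<in> lists A" for w
    using that
  proof (induction rule: lists.induct)
    case Nil
    then show ?case by (auto intro!: bexI[of _ "[]"] word_cong.refl)
  next
    case (Cons a w)
    from Cons.IH obtain w' where w': "w' \<in> lists A" "(w' @ w, []) \<in> word_cong A R" by blast
    obtain c where c: "c \<in> lists A" "(c @ [a], []) \<in> word_cong A R"
      using inv[OF Cons.hyps(1)] by blast
    have "(w' @ (c @ [a]) @ w, w' @ [] @ w) \<in> word_cong A R"
      using Cons w'(1) by (intro word_cong_context[OF c(2)]) auto
    then have "((w' @ c) @ a # w, []) \<in> word_cong A R"
      using word_cong.trans[OF _ w'(2)] by simp
    then show ?case using w'(1) c(1) by (intro bexI[of _ "w' @ c"]) auto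
  qed
  interpret monoid "presented_monoid A R" by (rule monoid_presented_monoid)
  show ?thesis
  proof (rule groupI)
    fix X assume "X \<in> carrier (presented_monoid A R)"
    then obtain w where w: "w \<in> lists A" "X = word_cong A R `` {w}"
      by (rule presented_monoid_carrierE)
    from word_inv[OF w(1)] obtain w' where w': "w' \<in> lists A" "(w' @ w, []) \<in> word_cong A R"
      by blast
    have "word_cong A R `` {w'} \<otimes>\<^bsub>presented_monoid A R\<^esub> X = \<one>\<^bsub>presented_monoid A R\<^esub>"
      unfolding w(2) presented_monoid_mult[OF w'(1) w(1)] presented_monoid_one
      by (rule presented_monoid_class_eq[OF w'(2)])
    then show "\<exists>Y \<in> carrier (presented_monoid A R).
        Y \<otimes>\<^bsub>presented_monoid A R\<^esub> X = \<one>\<^bsub>presented_monoid A R\<^esub>"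
      using presented_monoid_class_in_carrier[OF w'(1)] by blast
  qed (simp_all add: m_assoc)
qed

lemma group_presented_group: "group (presented_group S R)"
  unfolding presented_group_def
proof (rule group_presented_monoid)
  let ?A = "S \<times> (UNIV :: bool set)"
  let ?Q = "{([(s, b), (s, \<not> b)], []) | s b. s \<in> S} \<union> {(r, []) | r. r \<in> R}"
  fix a assume "a \<in> ?A"
  then obtain s b where a: "a = (s, b)" "s \<in> S" by auto
  have "([(s, \<not> b), (s, b)], []) \<in> ?Q" using a(2) by force
  from word_cong.rel[OF this, of ?A "[]" "[]"]
  have "([(s, \<not> b)] @ [a], []) \<in> word_cong ?A ?Q" using a by simp
  then show "\<exists>w \<in> lists ?A. (w @ [a], []) \<in> word_cong ?A ?Q"
    using a by (intro bexI[of _ "[(s, \<not> b)]"]) auto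
qed

lemma group_free_product:
  assumes G: "\<And>i. i \<in> I \<Longrightarrow> group (G i)"
  shows "group (free_product I G)"
  unfolding free_product_def
proof (rule group_presented_monoid)
  let ?A = "SIGMA i:I. carrier (G i)"
  let ?Q = "{([(i, x), (i, y)], [(i, x \<otimes>\<^bsub>G i\<^esub> y)]) | i x y.
               i \<in> I \<and> x \<in> carrier (G i) \<and> y \<in> carrier (G i)}
            \<union> {([(i, \<one>\<^bsub>G i\<^esub>)], []) | i. i \<in> I}"
  fix a assume "a \<in> ?A"
  then obtain i x where a: "a = (i, x)" "i \<in> I" "x \<in> carrier (G i)" by auto
  interpret group "G i" using G a(2) by blast
  let ?y = "inv\<^bsub>G i\<^esub> x"
  have y: "?y \<in> carrier (G i)" using a by simp
  have Q: "([(i, ?y), (i, x)], [(i, \<one>\<^bsub>G i\<^esub>)]) \<in> ?Q" "([(i, \<one>\<^bsub>G i\<^esub>)], []) \<in> ?Q"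
    using a y l_inv[OF a(3)] by force+
  have "([(i, ?y), (i, x)], [(i, \<one>\<^bsub>G i\<^esub>)]) \<in> word_cong ?A ?Q"
    using word_cong.rel[OF Q(1), of ?A "[]" "[]"] a y by simp
  moreover have "([(i, \<one>\<^bsub>G i\<^esub>)], []) \<in> word_cong ?A ?Q"
    using word_cong.rel[OF Q(2), of ?A "[]" "[]"] a by simp
  ultimately have "([(i, ?y), (i, x)], []) \<in> word_cong ?A ?Q"
    by (rule word_cong.trans)
  then show "\<exists>w \<in> lists ?A. (w @ [a], []) \<in> word_cong ?A ?Q"
    using a y by (intro bexI[of _ "[(i, ?y)]"]) simp_all
qed

end

(*
  An element of finite order in a free product is the identity or conjugate into a factor, and
  free and surface groups are torsion-free, so it suffices to treat an element x of order d of a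
  finite factor G: the restriction of a uniformly random homomorphism to a factor is uniformly
  random.

  For finite G put a(N) = |Hom(G, S_N)| / N!. Counting pairs (phi, y) for which y has stabilizer
  H shows that the expected number of such y is a(N - [G:H]) / a(N), hence
  E fix_x(N) is the sum of a(N - [G:H]) / a(N) over the subgroups H containing x. For x = 1 this
  is the recurrence N a(N) = sum_H a(N - [G:H]), i.e. the generating function of a is the
  exponential of sum_H X^[G:H] / [G:H]. The number of points with stabilizer H has nonnegative
  variance, which gives rho(N) <= rho(N - m) + m for rho(N) = a(N - m) / a(N), m = [G:H].
  Multiplying |H| consecutive ratios telescopes to a(N - |G|) / a(N) <= N, so
  rho(N) <= N^(1/|H|) + O(1). Inserting this into the recurrence bounds a(N - |G|) / a(N) from
  below by N - O(sqrt N), whence rho(N) >= N^(1/|H|) - O(1) if |H| > 1. The subgroup generated by x gives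
  the main term, and every other subgroup containing x has order at least 2d.
*)

theory Submission
  imports
    Defs
    "HOL-Computational_Algebra.Formal_Power_Series"
    "HOL-Algebra.Left_Coset"
begin

unbundle no vec_syntax
unbundle fps_syntax

section \<open>Ratios of coefficients of exponential series\<close>

text \<open>The comparison rho(N) <= rho(N - m) + m goes one way and only along N, N - m, N - 2m,
  ...; these are exactly the arguments in the telescoped product. A lower bound for one factor is
  therefore obtained by dividing the lower bound for the whole product by the upper bounds for the
  remaining |H| - 1 factors, and Bernoulli's inequality shows that the quotient loses only a
  constant. This takes at least two factors, because the product itself is known only up to O(sqrt
  N). In the remaining case x = 1 the sum runs over all subgroups and equals N exactly.

  On the algebraic side normal forms enter as the nontriviality of reduced words, supplied by an
  action on reduced words; a word of minimal length in a conjugacy class then settles torsion. For a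
  surface group free cancellation alone does not give normal forms, so the argument passes to the
  free group that describes the kernel of one exponent sum.\<close>

text \<open>The power series of \<open>exp (X ^ m / m)\<close>.\<close>

definition cycle_series :: "nat \<Rightarrow> real fps" where
  "cycle_series m =
     Abs_fps (\<lambda>i. if m dvd i then 1 / (real m ^ (i div m) * fact (i div m)) else 0)"

lemma cycle_series_nonneg: "cycle_series m $ i \<ge> 0"
  by (simp add: cycle_series_def)

lemma cycle_series_0: "cycle_series m $ 0 = 1"
  by (simp add: cycle_series_def)

lemma euler_nth: "(fps_X * fps_deriv f) $ i = of_nat i * (f $ i :: real)"
  by (cases i) simp_all

text \<open>The Euler operator X d/dX sends X^m / m to X^m, so this is the differential equation of
  exp (X^m / m). The operator multiplies the i-th coefficient by i, which matches the factor N in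
  the recurrence for a.\<close>

lemma euler_cycle_series:
  assumes "m > 0"
  shows "fps_X * fps_deriv (cycle_series m) = fps_X ^ m * cycle_series m"
proof (rule fps_ext)
  fix i
  show "(fps_X * fps_deriv (cycle_series m)) $ i = (fps_X ^ m * cycle_series m) $ i"
  proof (cases "m dvd i \<and> i > 0")
    case True
    then obtain q where q: "i = m * q" by (elim conjE dvdE)
    with True obtain r where r: "q = Suc r" by (cases q) auto
    have "real i * cycle_series m $ i = real (m * Suc r) / (real m ^ Suc r * fact (Suc r))"
      using assms by (simp add: q r cycle_series_def)
    also have "real m ^ Suc r * fact (Suc r) = real (m * Suc r) * (real m ^ r * fact r)"
      by (simp add: algebra_simps)
    also have "real (m * Suc r) / \<dots> = 1 / (real m ^ r * fact r)"
      by (rule nonzero_divide_mult_cancel_left) (use assms in \<open>simp del: of_nat_mult mult_Suc_right\<close>)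
    also have "\<dots> = cycle_series m $ (i - m)"
      using assms by (simp add: q r cycle_series_def)
    finally show ?thesis
      using assms q r by (simp add: euler_nth fps_X_power_mult_nth del: fps_X_mult_nth)
  next
    case False
    then have "real i * cycle_series m $ i = 0" by (auto simp: cycle_series_def)
    moreover have "m \<le> i \<Longrightarrow> \<not> m dvd i - m"
      using False assms by (metis dvd_diffD dvd_refl gr0I le_zero_eq not_gr0)
    ultimately show ?thesis
      by (auto simp: euler_nth fps_X_power_mult_nth cycle_series_def simp del: fps_X_mult_nth)
  qed
qed

text \<open>Logarithmic derivatives add. Read coefficientwise, the identity is the recurrence of
  \<open>orbit_recurrence\<close>.\<close>

lemma euler_prod_cycle_series:
  assumes "finite I" "\<And>h. h \<in> I \<Longrightarrow> \<mu> h > 0"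
  shows "fps_X * fps_deriv (\<Prod>h\<in>I. cycle_series (\<mu> h))
    = (\<Sum>h\<in>I. fps_X ^ \<mu> h * (\<Prod>h\<in>I. cycle_series (\<mu> h)))"
  using assms
proof (induction I rule: finite_induct)
  case (insert k I)
  let ?P = "\<Prod>h\<in>I. cycle_series (\<mu> h)" and ?E = "cycle_series (\<mu> k)"
  have "fps_X * fps_deriv (?E * ?P) = ?P * (fps_X * fps_deriv ?E) + ?E * (fps_X * fps_deriv ?P)"
    by (simp add: algebra_simps)
  also have "\<dots> = ?P * (fps_X ^ \<mu> k * ?E) + ?E * (\<Sum>h\<in>I. fps_X ^ \<mu> h * ?P)"
    using insert by (simp add: euler_cycle_series)
  also have "\<dots> = fps_X ^ \<mu> k * (?E * ?P) + (\<Sum>h\<in>I. fps_X ^ \<mu> h * (?E * ?P))"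
    by (simp add: sum_distrib_left mult_ac)
  finally show ?case using insert.hyps by simp
qed simp

lemma prod_fps_nonneg:
  fixes f :: "'h \<Rightarrow> real fps"
  assumes "finite I" "\<And>h i. h \<in> I \<Longrightarrow> f h $ i \<ge> 0"
  shows "(\<Prod>h\<in>I. f h) $ i \<ge> 0"
  using assms
  by (induction I arbitrary: i rule: finite_induct) (auto simp: fps_mult_nth intro!: sum_nonneg)

text \<open>The instance in mind has the subgroups of a finite group as \<open>I\<close>, their
  indices as \<open>\<mu>\<close>, and |Hom(G, S_N)| / N! as \<open>a N\<close>. The whole group
  then provides \<open>index_one\<close>; its term a (N - 1) keeps every \<open>a N\<close>
  positive.\<close>

locale orbit_recurrence =
  fixes I :: "'h set" and \<mu> :: "'h \<Rightarrow> nat" and a :: "nat \<Rightarrow> real"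
  assumes finite_I: "finite I"
    and index_pos: "h \<in> I \<Longrightarrow> \<mu> h > 0"
    and a_0: "a 0 = 1"
    and recurrence: "real N * a N = (\<Sum>h\<in>I. if \<mu> h \<le> N then a (N - \<mu> h) else 0)"
    and index_one: "\<exists>h\<in>I. \<mu> h = 1"
begin

text \<open>For a finite group this is the expected number of points with a given stabilizer of
  index m. The value 0 for m > N keeps \<open>ratio_step\<close> true for N < 2 m, where no second
  orbit of size m fits and the second moment loses its last term.\<close>

definition ratio :: "nat \<Rightarrow> nat \<Rightarrow> real" where
  "ratio m N = (if m \<le> N then a (N - m) / a N else 0)"

lemma a_pos: "a N > 0"
proof (induction N rule: less_induct)
  case (less N)
  show ?case
  proof (cases "N = 0")
    case False
    obtain h where h: "h \<in> I" "\<mu> h = 1" using index_one by blast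
    have "0 < (\<Sum>h\<in>I. if \<mu> h \<le> N then a (N - \<mu> h) else 0)"
      by (rule sum_pos2[OF finite_I h(1)]) (use False h less.IH index_pos in \<open>auto intro!: less_imp_le\<close>)
    then show ?thesis
      using False unfolding recurrence[symmetric] by (simp add: zero_less_mult_iff)
  qed (simp add: a_0)
qed

text \<open>Both sequences start at 1 and obey the same recurrence, which determines its solution
  because the factor N is nonzero for N > 0. The product form allows one factor to be split off,
  with nonnegative coefficients in both parts.\<close>

lemma nth_prod_cycle_series: "(\<Prod>h\<in>I. cycle_series (\<mu> h)) $ N = a N"
proof (induction N rule: less_induct)
  case (less N)
  let ?F = "\<Prod>h\<in>I. cycle_series (\<mu> h)"
  show ?case
  proof (cases "N = 0")
    case True
    have "?F $ 0 = (\<Prod>h\<in>I. cycle_series (\<mu> h) $ 0)"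
      using finite_I by (induction I rule: finite_induct) simp_all
    then show ?thesis using True by (simp add: cycle_series_0 a_0)
  next
    case False
    have "real N * ?F $ N = (\<Sum>h\<in>I. fps_X ^ \<mu> h * ?F) $ N"
      using euler_prod_cycle_series[OF finite_I index_pos] by (simp flip: euler_nth)
    also have "\<dots> = (\<Sum>h\<in>I. if \<mu> h \<le> N then a (N - \<mu> h) else 0)"
      unfolding fps_sum_nth
      by (rule sum.cong) (use False index_pos less.IH in \<open>auto simp: fps_X_power_mult_nth\<close>)
    finally show ?thesis using False by (simp flip: recurrence)
  qed
qed

text \<open>
  Splitting off the factor of \<^term>\<open>h\<close> exhibits \<^term>\<open>a N\<close> as the total mass of a measure on
  \<^term>\<open>{0..N}\<close> whose first two moments are again values of \<^term>\<open>a\<close>; the estimate is the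
  Cauchy-Schwarz inequality for these moments.
\<close>

lemma ratio_step:
  assumes h: "h \<in> I" and N: "\<mu> h \<le> N"
  shows "ratio (\<mu> h) N \<le> ratio (\<mu> h) (N - \<mu> h) + \<mu> h"
proof -
  define m where "m = \<mu> h"
  define E where "E = cycle_series m"
  define F' where "F' = (\<Prod>k\<in>I - {h}. cycle_series (\<mu> k))"
  have m: "m > 0" "m \<le> N" using h N index_pos by (simp_all add: m_def)
  have F: "E * F' = (\<Prod>k\<in>I. cycle_series (\<mu> k))"
    unfolding E_def F'_def m_def by (rule prod.remove[OF finite_I h, symmetric])
  have nth_F: "(E * F') $ j = a j" for j by (simp add: F nth_prod_cycle_series)
  have euler: "fps_X * fps_deriv E = fps_X ^ m * E"
    unfolding E_def by (rule euler_cycle_series[OF m(1)])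
  \<comment> \<open>For subgroups: choose a uniformly random base point in each orbit. Then
    \<open>p i / a N\<close> is the probability that the orbits whose base point has stabilizer
    \<open>h\<close> cover exactly i points; the mean agrees with that of the number of points with
    stabilizer \<open>h\<close>.\<close>
  define p where "p i = E $ i * F' $ (N - i)" for i
  have p: "p i \<ge> 0" for i
    unfolding p_def E_def F'_def
    by (intro mult_nonneg_nonneg cycle_series_nonneg prod_fps_nonneg) (use finite_I in simp_all)
  have moment0: "(\<Sum>i=0..N. p i) = a N"
    unfolding p_def nth_F[symmetric] fps_mult_nth ..
  have moment1: "(\<Sum>i=0..N. real i * p i) = a (N - m)"
  proof -
    have "(\<Sum>i=0..N. real i * p i) = ((fps_X * fps_deriv E) * F') $ N"
      unfolding fps_mult_nth[of "fps_X * fps_deriv E"] euler_nth by (simp add: p_def mult_ac)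
    also have "\<dots> = (fps_X ^ m * (E * F')) $ N" by (simp add: euler mult_ac)
    also have "\<dots> = a (N - m)" using m by (simp add: fps_X_power_mult_nth nth_F)
    finally show ?thesis .
  qed
  \<comment> \<open>Applying X d/dX twice weights by i^2. The second application hits X^m as well as
    E, and this produces the two terms.\<close>
  have moment2: "(\<Sum>i=0..N. (real i)\<^sup>2 * p i)
      = real m * a (N - m) + (if 2 * m \<le> N then a (N - 2 * m) else 0)"
  proof -
    have "fps_X * fps_deriv (fps_X ^ m * E)
        = (fps_X * fps_deriv (fps_X ^ m)) * E + fps_X ^ m * (fps_X * fps_deriv E)"
      by (simp add: algebra_simps)
    also have "fps_X * fps_deriv (fps_X ^ m) = of_nat m * (fps_X ^ m :: real fps)"
      by (rule fps_ext) (simp only: euler_nth, simp add: fps_X_power_nth)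
    finally have *: "fps_X * fps_deriv (fps_X * fps_deriv E)
        = of_nat m * (fps_X ^ m * E) + fps_X ^ (2 * m) * E"
      unfolding euler mult_2 power_add by (simp only: mult_ac)
    have "(\<Sum>i=0..N. (real i)\<^sup>2 * p i) = ((fps_X * fps_deriv (fps_X * fps_deriv E)) * F') $ N"
      unfolding fps_mult_nth[of "fps_X * fps_deriv (fps_X * fps_deriv E)"] euler_nth
      by (rule sum.cong) (simp_all add: p_def power2_eq_square)
    also have "\<dots> = (of_nat m * (fps_X ^ m * (E * F')) + fps_X ^ (2 * m) * (E * F')) $ N"
      unfolding * by (simp only: algebra_simps)
    also have "\<dots> = real m * a (N - m) + (if 2 * m \<le> N then a (N - 2 * m) else 0)"
      using m by (simp add: fps_of_nat[symmetric] fps_X_power_mult_nth nth_F)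
    finally show ?thesis .
  qed
  let ?A = "\<Sum>i=0..N. p i" and ?B = "\<Sum>i=0..N. real i * p i" and ?C = "\<Sum>i=0..N. (real i)\<^sup>2 * p i"
  \<comment> \<open>The variance with denominators cleared; the mean is
    \<open>?B / ?A\<close>.\<close>
  have "(\<Sum>i=0..N. p i * (real i * ?A - ?B)\<^sup>2)
      = (\<Sum>i=0..N. ?A\<^sup>2 * ((real i)\<^sup>2 * p i) - 2 * ?A * ?B * (real i * p i) + ?B\<^sup>2 * p i)"
    by (rule sum.cong) (simp_all add: power2_eq_square algebra_simps)
  also have "\<dots> = ?A\<^sup>2 * ?C - 2 * ?A * ?B * ?B + ?B\<^sup>2 * ?A"
    by (simp only: sum.distrib sum_subtractf flip: sum_distrib_left)
  also have "\<dots> = ?A * (?A * ?C - ?B\<^sup>2)" by (simp add: power2_eq_square algebra_simps)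
  finally have "?A * (?A * ?C - ?B\<^sup>2) \<ge> 0"
    using p by (metis (no_types, lifting) mult_nonneg_nonneg sum_nonneg zero_le_power2)
  moreover have "?A > 0" unfolding moment0 by (rule a_pos)
  ultimately have "?B\<^sup>2 \<le> ?A * ?C" by (simp add: zero_le_mult_iff)
  then have le: "(a (N - m))\<^sup>2
      \<le> a N * (real m * a (N - m) + (if 2 * m \<le> N then a (N - 2 * m) else 0))"
    unfolding moment0 moment1 moment2 .
  have "N - m - m = N - 2 * m" by simp
  moreover have "(m \<le> N - m) = (2 * m \<le> N)" using m by linarith
  ultimately have "ratio m N \<le> ratio m (N - m) + real m"
    using le m a_pos[of N] a_pos[of "N - m"]
    by (auto simp: ratio_def field_simps power2_eq_square split: if_splits)
  then show ?thesis by (simp add: m_def)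
qed

end

text \<open>Here n is the group order and \<open>t\<close> the trivial subgroup, the only one of
  index n. Its ratio is the one compared directly with N; every other index is a proper divisor of
  n, hence at most n / 2.\<close>

locale orbit_recurrence_top = orbit_recurrence +
  fixes n :: nat and t :: 'h
  assumes top: "t \<in> I" "\<mu> t = n"
    and index_dvd: "h \<in> I \<Longrightarrow> \<mu> h dvd n"
    and index_unique: "h \<in> I \<Longrightarrow> \<mu> h = n \<Longrightarrow> h = t"
begin

lemma n_pos: "n > 0"
  using index_pos top by blast

lemma ratio_nonneg: "ratio m N \<ge> 0"
  using a_pos[of N] a_pos[of "N - m"] by (simp add: ratio_def)

lemma sum_ratio:
  assumes "N > 0"
  shows "(\<Sum>h\<in>I. ratio (\<mu> h) N) = real N"
proof -
  have "(\<Sum>h\<in>I. ratio (\<mu> h) N) = (\<Sum>h\<in>I. if \<mu> h \<le> N then a (N - \<mu> h) else 0) / a N"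
    unfolding sum_divide_distrib by (rule sum.cong) (auto simp: ratio_def)
  then show ?thesis
    using a_pos[of N] by (simp flip: recurrence)
qed

section \<open>Upper and lower bounds for the ratios\<close>

lemma ratio_steps:
  assumes "h \<in> I" "j * \<mu> h \<le> N"
  shows "ratio (\<mu> h) N \<le> ratio (\<mu> h) (N - j * \<mu> h) + real (j * \<mu> h)"
  using assms(2)
proof (induction j)
  case (Suc j)
  then have "\<mu> h \<le> N - j * \<mu> h" by simp
  from ratio_step[OF assms(1) this] Suc show ?case
    by (simp add: add.commute)
qed simp

lemma ratio_telescope:
  assumes "d * m \<le> N"
  shows "(\<Prod>j<d. ratio m (N - j * m)) = ratio (d * m) N"
  using assms
proof (induction d)
  case 0
  then show ?case using a_pos[of N] by (simp add: ratio_def)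
next
  case (Suc d)
  then show ?case
    using a_pos[of N] a_pos[of "N - d * m"]
    by (simp add: ratio_def add.commute)
qed

lemma ratio_n_le: "N > 0 \<Longrightarrow> ratio n N \<le> real N"
  using member_le_sum[OF top(1), of "\<lambda>h. ratio (\<mu> h) N"] ratio_nonneg finite_I
  by (simp add: sum_ratio top)

text \<open>By \<open>ratio_steps\<close> each of the d factors ratio m (N - j m) of the telescoped
  product is at least ratio m N - n, since j m <= n. The product is \<open>ratio n N\<close>, at
  most N, so the d-th power of ratio m N - n is at most N. The initial case distinction makes this
  base nonnegative, as multiplying the d inequalities requires.\<close>

lemma ratio_upper:
  assumes h: "h \<in> I" and N: "N \<ge> n" and d: "n = d * \<mu> h"
  shows "ratio (\<mu> h) N \<le> real N powr (1 / real d) + real n"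
proof (cases "ratio (\<mu> h) N \<le> real n")
  case False
  define m where "m = \<mu> h"
  have "N > 0" using n_pos N by linarith
  moreover have "d > 0" using n_pos d by (cases d) auto
  ultimately have pos: "d > 0" "N > 0" by simp_all
  have "(ratio m N - real n) ^ d = (\<Prod>j<d. ratio m N - real n)" by simp
  also have "\<dots> \<le> (\<Prod>j<d. ratio m (N - j * m))"
  proof (rule prod_mono)
    fix j assume "j \<in> {..<d}"
    then have j: "j * m \<le> n" unfolding d m_def by simp
    then have "ratio m N \<le> ratio m (N - j * m) + real (j * m)"
      using ratio_steps[OF h, of j N] N by (simp add: m_def)
    then show "0 \<le> ratio m N - real n \<and> ratio m N - real n \<le> ratio m (N - j * m)"
      using False j by (simp add: m_def flip: of_nat_mult)
  qed
  also have "\<dots> = ratio n N"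
    using ratio_telescope[of d m N] d N by (simp add: m_def)
  also have "\<dots> \<le> real N" using pos by (simp add: ratio_n_le)
  finally have "(ratio m N - real n) ^ d \<le> (real N powr (1 / real d)) ^ d"
    using pos by (simp add: powr_power)
  then have "ratio m N - real n \<le> real N powr (1 / real d)"
    by (subst (asm) power_mono_iff) (use False pos in \<open>auto simp: m_def\<close>)
  then show ?thesis by (simp add: m_def)
qed (smt (verit) powr_ge_zero)

text \<open>The factor 1 + n absorbs the additive error n of \<open>ratio_upper\<close> into a power
  of N that is at least 1; \<open>card I\<close> bounds the number of summands.\<close>

definition ratio_const :: real where "ratio_const = real (card I) * (1 + real n)"

lemma ratio_upper_root:
  assumes h: "h \<in> I" and N: "N \<ge> n" and d: "n = d * \<mu> h" and c: "0 < c" "c \<le> d"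
  shows "ratio (\<mu> h) N \<le> (1 + real n) * real N powr (1 / real c)"
proof -
  have N1: "real N \<ge> 1" using N n_pos by simp
  have "ratio (\<mu> h) N \<le> real N powr (1 / real d) + real n"
    by (rule ratio_upper[OF h N d])
  also have "real N powr (1 / real d) \<le> real N powr (1 / real c)"
    using N1 c by (intro powr_mono) (auto simp: field_simps)
  also have "real n \<le> real n * real N powr (1 / real c)"
    using N1 ge_one_powr_ge_zero[of "real N" "1 / real c"] by (simp add: mult_le_cancel_left1)
  finally show ?thesis by (simp add: algebra_simps)
qed

text \<open>The parameter c is a lower bound for the orders of the subgroups in \<open>J\<close>. It
  is 2 for the nontrivial subgroups and 2 d for the subgroups that properly contain a cyclic group
  of order d; the latter gives the exponent 1 / (2 d) of the error term.\<close>

lemma sum_ratio_upper: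
  assumes J: "J \<subseteq> I" and N: "N \<ge> n" and c: "c > 0"
    and le: "\<And>h. h \<in> J \<Longrightarrow> c * \<mu> h \<le> n"
  shows "(\<Sum>h\<in>J. ratio (\<mu> h) N) \<le> ratio_const * real N powr (1 / real c)"
proof -
  have "(\<Sum>h\<in>J. ratio (\<mu> h) N) \<le> (\<Sum>h\<in>J. (1 + real n) * real N powr (1 / real c))"
  proof (rule sum_mono)
    fix h assume h: "h \<in> J"
    then obtain d where d: "n = d * \<mu> h" using J index_dvd by (metis dvdE mult.commute subsetD)
    then have "c \<le> d" using le[OF h] index_pos[of h] h J by auto
    then show "ratio (\<mu> h) N \<le> (1 + real n) * real N powr (1 / real c)"
      using ratio_upper_root[OF _ N d c] h J by blast
  qed
  also have "\<dots> = real (card J) * ((1 + real n) * real N powr (1 / real c))" by simp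
  also have "\<dots> \<le> real (card I) * ((1 + real n) * real N powr (1 / real c))"
    by (intro mult_right_mono) (use J finite_I card_mono in auto)
  finally show ?thesis by (simp add: ratio_const_def mult.assoc)
qed

lemma ratio_n_lower:
  assumes N: "N \<ge> n"
  shows "ratio n N \<ge> real N - ratio_const * sqrt (real N)"
proof -
  have "real N = (\<Sum>h\<in>I. ratio (\<mu> h) N)" using N n_pos by (simp add: sum_ratio)
  also have "\<dots> = ratio n N + (\<Sum>h\<in>I - {t}. ratio (\<mu> h) N)"
    using sum.remove[OF finite_I top(1), of "\<lambda>h. ratio (\<mu> h) N"] top by simp
  also have "(\<Sum>h\<in>I - {t}. ratio (\<mu> h) N) \<le> ratio_const * real N powr (1 / real 2)"
  proof (rule sum_ratio_upper[OF _ N])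
    fix h assume h: "h \<in> I - {t}"
    then obtain d where d: "n = \<mu> h * d" using index_dvd by blast
    moreover have "d \<noteq> 0" "d \<noteq> 1" using d h index_unique n_pos by auto
    ultimately show "2 * \<mu> h \<le> n" by (cases d) auto
  qed auto
  finally show ?thesis by (simp add: powr_half_sqrt)
qed

text \<open>With r = N^(1/d) and C for \<open>ratio_const\<close>, the telescoped product is at
  least r^(d-1) (r - C), while each of its last d - 1 factors is at most r + n. Hence the first
  factor is at least (r - C) (r / (r + n))^(d-1), and Bernoulli's inequality makes the loss a
  constant. The bound N >= 2 n keeps the shifted arguments in the range of
  \<open>ratio_upper\<close>, and \<open>large\<close> makes r - C nonnegative.\<close>

lemma ratio_lower:
  assumes h: "h \<in> I" and N: "N \<ge> 2 * n" and d: "n = d * \<mu> h" "d \<ge> 2"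
    and large: "real N powr (1 / real d) \<ge> ratio_const"
  shows "ratio (\<mu> h) N \<ge> real N powr (1 / real d) - ratio_const - real (d - 1) * real n"
proof -
  define m where "m = \<mu> h"
  define r where "r = real N powr (1 / real d)"
  obtain e where e: "d = Suc e" "e \<ge> 1" using d(2) by (cases d) auto
  have N1: "real N \<ge> 1" using N n_pos by simp
  have r1: "r \<ge> 1" unfolding r_def by (rule ge_one_powr_ge_zero) (use N1 in auto)
  have r_pow: "r ^ Suc e = real N"
    using N1 by (simp add: r_def e powr_power del: power_Suc)
  have C0: "ratio_const \<ge> 0" by (simp add: ratio_const_def)
  \<comment> \<open>This is 1/2 <= (d - 1) / d, the place where d >= 2 enters.\<close>
  have "sqrt (real N) \<le> r ^ e"
  proof -
    have "sqrt (real N) = real N powr (1 / 2)" using N1 by (simp add: powr_half_sqrt)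
    also have "\<dots> \<le> real N powr (real e / real d)"
      using N1 e by (intro powr_mono) (auto simp: field_simps)
    also have "\<dots> = r ^ e" using N1 by (simp add: r_def powr_power)
    finally show ?thesis .
  qed
  then have "ratio_const * sqrt (real N) \<le> ratio_const * r ^ e" using C0 by (rule mult_left_mono)
  then have "r ^ e * (r - ratio_const) \<le> real N - ratio_const * sqrt (real N)"
    unfolding r_pow[symmetric] by (simp add: algebra_simps)
  also have "\<dots> \<le> ratio n N" using N by (intro ratio_n_lower) simp
  also have "\<dots> = (\<Prod>j<Suc e. ratio m (N - j * m))"
    using ratio_telescope[of d m N] d N by (simp add: m_def e)
  also have "\<dots> = ratio m N * (\<Prod>j<e. ratio m (N - Suc j * m))"
    by (subst prod.lessThan_Suc_shift) simp
  also have "\<dots> \<le> ratio m N * (\<Prod>j<e. r + real n)"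
  proof (intro mult_left_mono prod_mono conjI ratio_nonneg)
    fix j assume "j \<in> {..<e}"
    then have "Suc j * m \<le> n" unfolding d m_def e by (intro mult_le_mono1) simp
    then have "ratio m (N - Suc j * m) \<le> real (N - Suc j * m) powr (1 / real d) + real n"
      unfolding m_def using N by (intro ratio_upper[OF h _ d(1)]) simp
    also have "real (N - Suc j * m) powr (1 / real d) \<le> r"
      unfolding r_def by (intro powr_mono2) auto
    finally show "ratio m (N - Suc j * m) \<le> r + real n" by simp
  qed
  finally have key: "r ^ e * (r - ratio_const) \<le> ratio m N * (r + real n) ^ e" by simp
  \<comment> \<open>Chosen so that 1 - u = r / (r + n), the base to which Bernoulli's inequality is
    applied.\<close>
  define u where "u = real n / (r + real n)"
  have rn: "r + real n > 0" using r1 by simp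
  have u: "u \<le> 1" "u \<le> real n / r" using r1 rn by (auto simp: u_def field_simps)
  have "1 - real e * (real n / r) \<le> 1 + real e * (- u)"
    using mult_left_mono[OF u(2), of "real e"] by simp
  also have "\<dots> \<le> (1 + - u) ^ e" by (rule Bernoulli_inequality) (use u in simp)
  also have "1 + - u = r / (r + real n)" using rn by (simp add: u_def field_simps)
  finally have bern: "1 - real e * (real n / r) \<le> r ^ e / (r + real n) ^ e"
    by (simp add: power_divide)
  have "r - ratio_const - real e * real n \<le> (r - ratio_const) * (1 - real e * (real n / r))"
    using C0 r1 by (simp add: field_simps)
  also have "\<dots> \<le> (r - ratio_const) * (r ^ e / (r + real n) ^ e)"
    using bern large by (intro mult_left_mono) (auto simp: r_def)
  also have "\<dots> \<le> ratio m N"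
    using key rn by (simp add: field_simps)
  finally show ?thesis by (simp add: r_def m_def e)
qed

theorem sum_ratio_asymptotics:
  assumes h: "h \<in> J" and J: "J \<subseteq> I" and d: "n = d * \<mu> h"
    and others: "\<And>k. k \<in> J \<Longrightarrow> k \<noteq> h \<Longrightarrow> 2 * d * \<mu> k \<le> n"
    and one: "d = 1 \<Longrightarrow> J = I"
  shows "(\<lambda>N. (\<Sum>k\<in>J. ratio (\<mu> k) N) - real N powr (1 / real d))
           \<in> O(\<lambda>N. real N powr (1 / (2 * real d)))"
proof (cases "d = 1")
  case True
  have "\<forall>\<^sub>F N in sequentially. (\<Sum>k\<in>J. ratio (\<mu> k) N) - real N powr (1 / real d) = 0"
    using eventually_gt_at_top[of 0] by eventually_elim (simp add: one True sum_ratio)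
  then show ?thesis by (rule landau_o.big.in_cong[THEN iffD2]) simp
next
  case False
  have "d \<noteq> 0" using d n_pos by auto
  with False have d2: "d \<ge> 2" by simp
  have "filterlim (\<lambda>N. real N powr (1 / real d)) at_top sequentially"
    using d2 by real_asymp
  then have "\<forall>\<^sub>F N in sequentially. real N powr (1 / real d) \<ge> ratio_const"
    by (simp add: filterlim_at_top)
  then have "\<forall>\<^sub>F N in sequentially.
      norm ((\<Sum>k\<in>J. ratio (\<mu> k) N) - real N powr (1 / real d))
        \<le> (2 * ratio_const + real n + real d * real n) * norm (real N powr (1 / (2 * real d)))"
    using eventually_ge_at_top[of "2 * n"]
  proof eventually_elim
    case (elim N)
    let ?q = "real N powr (1 / (2 * real d))"
    have "real n \<ge> 0" by simp
    \<comment> \<open>Linear arithmetic for a main term \<rho>, a remainder s and the root r, with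
      c, x and y standing for products. The additive constants are afterwards multiplied by
      \<open>?q\<close>, which is at least 1; this is how the constant of the estimate
      arises.\<close>
    then have aux: "\<bar>\<rho> + s - r\<bar> \<le> c + (ratio_const + real n + y) * 1"
      if "s \<le> c" "0 \<le> s" "\<rho> \<le> r + real n" "r - ratio_const - x \<le> \<rho>" "0 \<le> y" "x \<le> y" "0 \<le> ratio_const"
      for \<rho> s r c x y
      using that by (simp add: abs_le_iff)
    have hI: "h \<in> I" using h J by blast
    have C0: "ratio_const \<ge> 0" by (simp add: ratio_const_def)
    have "real N \<ge> 1" using elim n_pos by simp
    then have q1: "?q \<ge> 1" by (rule ge_one_powr_ge_zero) simp
    have split: "(\<Sum>k\<in>J. ratio (\<mu> k) N) = ratio (\<mu> h) N + (\<Sum>k\<in>J - {h}. ratio (\<mu> k) N)"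
      using sum.remove[OF finite_subset[OF J finite_I] h, of "\<lambda>k. ratio (\<mu> k) N"] .
    have "(\<Sum>k\<in>J - {h}. ratio (\<mu> k) N) \<le> ratio_const * ?q"
      using sum_ratio_upper[of "J - {h}" N "2 * d"] J elim d2 others by auto
    moreover have "(\<Sum>k\<in>J - {h}. ratio (\<mu> k) N) \<ge> 0" by (intro sum_nonneg ratio_nonneg)
    moreover have "ratio (\<mu> h) N \<le> real N powr (1 / real d) + real n"
      by (rule ratio_upper[OF hI _ d]) (use elim in simp)
    moreover have "ratio (\<mu> h) N \<ge> real N powr (1 / real d) - ratio_const - real (d - 1) * real n"
      by (rule ratio_lower[OF hI _ d d2]) (use elim in auto)
    moreover have "0 \<le> real d * real n" by simp
    moreover have "real (d - 1) * real n \<le> real d * real n" by (intro mult_right_mono) auto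
    ultimately have "\<bar>(\<Sum>k\<in>J. ratio (\<mu> k) N) - real N powr (1 / real d)\<bar>
        \<le> ratio_const * ?q + (ratio_const + real n + real d * real n) * 1"
      unfolding split using C0 by - (rule aux, simp_all)
    also have "\<dots> \<le> ratio_const * ?q + (ratio_const + real n + real d * real n) * ?q"
      using q1 C0 by (intro add_left_mono mult_left_mono) auto
    finally show ?case by (simp add: algebra_simps)
  qed
  then show ?thesis by (rule bigoI)
qed

end

section \<open>Counting actions of a finite group\<close>

text \<open>The point set is an arbitrary S, because removing an orbit from {1..N} leaves a set that
  need not be an initial segment. The permutations remain functions on all natural numbers, equal to
  the identity off S.\<close>

definition actions :: "('a, 'm) monoid_scheme \<Rightarrow> nat set \<Rightarrow> ('a \<Rightarrow> nat \<Rightarrow> nat) set" where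
  "actions G S = {\<phi> \<in> carrier G \<rightarrow>\<^sub>E {p. p permutes S}.
     \<forall>g\<in>carrier G. \<forall>h\<in>carrier G. \<phi> (g \<otimes>\<^bsub>G\<^esub> h) = \<phi> g \<circ> \<phi> h}"

lemma perm_reps_eq_actions: "perm_reps G N = actions G {1..N}"
  by (auto simp: perm_reps_def actions_def hom_def sym_group_def PiE_def extensional_def Pi_def)

lemma actionsI:
  assumes "\<And>g. g \<in> carrier G \<Longrightarrow> \<phi> g permutes S"
    and "\<And>g. g \<notin> carrier G \<Longrightarrow> \<phi> g = undefined"
    and "\<And>g h. g \<in> carrier G \<Longrightarrow> h \<in> carrier G \<Longrightarrow> \<phi> (g \<otimes>\<^bsub>G\<^esub> h) = \<phi> g \<circ> \<phi> h"
  shows "\<phi> \<in> actions G S"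
  using assms by (auto simp: actions_def PiE_def extensional_def)

lemma actionsD:
  assumes "\<phi> \<in> actions G S"
  shows "g \<in> carrier G \<Longrightarrow> \<phi> g permutes S"
    and "g \<notin> carrier G \<Longrightarrow> \<phi> g = undefined"
    and "g \<in> carrier G \<Longrightarrow> h \<in> carrier G \<Longrightarrow> \<phi> (g \<otimes>\<^bsub>G\<^esub> h) = \<phi> g \<circ> \<phi> h"
  using assms by (auto simp: actions_def PiE_def extensional_def)

lemma finite_actions: "finite (carrier G) \<Longrightarrow> finite S \<Longrightarrow> finite (actions G S)"
  unfolding actions_def
  by (rule finite_subset[OF _ finite_PiE[of "carrier G" "\<lambda>_. {p. p permutes S}"]])
     (auto simp: finite_permutations)

lemma permutes_conjugate:
  assumes "p permutes S" "bij \<pi>"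
  shows "\<pi> \<circ> p \<circ> inv' \<pi> permutes \<pi> ` S"
proof -
  have bij: "bij (\<pi> \<circ> p \<circ> inv' \<pi>)"
    using assms permutes_bij by (intro bij_comp) (auto intro: bij_imp_bij_inv)
  have "(\<pi> \<circ> p \<circ> inv' \<pi>) y = y" if "y \<notin> \<pi> ` S" for y
  proof -
    have "inv' \<pi> y \<notin> S" using assms(2) that by (metis bij_inv_eq_iff image_eqI)
    then show ?thesis
      using assms by (simp add: permutes_not_in bij_is_surj surj_f_inv_f)
  qed
  then show ?thesis using bij by (simp add: permutes_def bij_iff)
qed

text \<open>Permutations here are functions on the whole type, so conjugating them calls for a
  bijection of the whole type. A bijection from S to T is completed by one from T - S to S - T and
  by the identity elsewhere.\<close>

lemma exists_bij_image_eq: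
  fixes S T :: "'b set"
  assumes "finite S" "finite T" "card S = card T"
  shows "\<exists>\<pi>. bij \<pi> \<and> \<pi> ` S = T"
proof -
  obtain f where f: "bij_betw f S T"
    using finite_same_card_bij[OF assms] by blast
  have "card (T - S) = card (S - T)"
    using assms card_le_sym_Diff[of S T] card_le_sym_Diff[of T S] by simp
  then obtain g where g: "bij_betw g (T - S) (S - T)"
    using finite_same_card_bij[of "T - S" "S - T"] assms by auto
  define \<pi> where "\<pi> x = (if x \<in> S then f x else if x \<in> T - S then g x else x)" for x
  have 1: "bij_betw \<pi> S T" using f by (rule bij_betw_cong[THEN iffD1, rotated]) (simp add: \<pi>_def)
  have 2: "bij_betw \<pi> (T - S) (S - T)"
    using g by (rule bij_betw_cong[THEN iffD1, rotated]) (simp add: \<pi>_def)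
  have 3: "bij_betw \<pi> (- (S \<union> T)) (- (S \<union> T))"
    using bij_betw_id by (rule bij_betw_cong[THEN iffD1, rotated]) (simp add: \<pi>_def)
  have "bij_betw \<pi> (S \<union> (T - S)) (T \<union> (S - T))" by (rule bij_betw_combine[OF 1 2]) blast
  from bij_betw_combine[OF this 3]
  have "bij_betw \<pi> (S \<union> (T - S) \<union> - (S \<union> T)) (T \<union> (S - T) \<union> - (S \<union> T))" by blast
  moreover have "S \<union> (T - S) \<union> - (S \<union> T) = UNIV" "T \<union> (S - T) \<union> - (S \<union> T) = UNIV" by blast+
  ultimately have "bij \<pi>" by simp
  then show ?thesis using 1 by (auto simp: bij_betw_def)
qed

context group
begin

lemma action_one:
  assumes "\<phi> \<in> actions G S"
  shows "\<phi> \<one> = id"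
proof -
  have "\<phi> \<one> \<circ> \<phi> \<one> = \<phi> \<one>" using actionsD(3)[OF assms one_closed one_closed] by simp
  moreover have "inj (\<phi> \<one>)" using actionsD(1)[OF assms one_closed] by (rule permutes_inj)
  ultimately show ?thesis by (simp add: fun_eq_iff inj_eq)
qed

lemma action_mult:
  assumes "\<phi> \<in> actions G S" "g \<in> carrier G" "h \<in> carrier G"
  shows "\<phi> (g \<otimes> h) x = \<phi> g (\<phi> h x)"
  using actionsD(3)[OF assms] by simp

lemma action_inv_eq_iff:
  assumes "\<phi> \<in> actions G S" "g \<in> carrier G"
  shows "\<phi> (inv g) x = y \<longleftrightarrow> x = \<phi> g y"
  using assms action_mult[OF assms(1), of g "inv g" x] action_mult[OF assms(1), of "inv g" g y]
  by (auto simp: action_one[OF assms(1)])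

text \<open>Conjugation by \<pi> maps actions injectively to actions. The reverse inequality comes
  from interchanging the two point sets.\<close>

lemma card_actions_image_le:
  assumes "finite (carrier G)" "finite S" "bij \<pi>"
  shows "card (actions G S) \<le> card (actions G (\<pi> ` S))"
proof (rule card_inj_on_le)
  let ?f = "\<lambda>\<phi>. \<lambda>g\<in>carrier G. \<pi> \<circ> \<phi> g \<circ> inv' \<pi>"
  have inv: "inv' \<pi> (\<pi> x) = x" for x using assms(3) by (simp add: bij_is_inj)
  show "inj_on ?f (actions G S)"
  proof (rule inj_onI, rule ext)
    fix \<phi> \<psi> g assume \<phi>\<psi>: "\<phi> \<in> actions G S" "\<psi> \<in> actions G S" and eq: "?f \<phi> = ?f \<psi>"
    show "\<phi> g = \<psi> g"
    proof (cases "g \<in> carrier G")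
      case True
      with fun_cong[OF eq, of g] have eq': "\<pi> \<circ> \<phi> g \<circ> inv' \<pi> = \<pi> \<circ> \<psi> g \<circ> inv' \<pi>" by simp
      show ?thesis
      proof
        fix x
        show "\<phi> g x = \<psi> g x"
          using fun_cong[OF eq', of "\<pi> x"] inv by (metis comp_apply)
      qed
    qed (use \<phi>\<psi> in \<open>simp add: actionsD(2)\<close>)
  qed
  show "?f ` actions G S \<subseteq> actions G (\<pi> ` S)"
  proof (rule image_subsetI, rule actionsI)
    fix \<phi> g h assume \<phi>: "\<phi> \<in> actions G S" and gh: "g \<in> carrier G" "h \<in> carrier G"
    show "?f \<phi> (g \<otimes> h) = ?f \<phi> g \<circ> ?f \<phi> h"
      using gh by (simp add: actionsD(3)[OF \<phi>] fun_eq_iff inv)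
  qed (use assms in \<open>auto intro: permutes_conjugate actionsD(1)\<close>)
qed (use assms in \<open>simp add: finite_actions\<close>)

lemma card_actions_eq:
  assumes "finite (carrier G)" "finite S" "finite T" "card S = card T"
  shows "card (actions G S) = card (actions G T)"
proof -
  have "card (actions G S) \<le> card (actions G T)"
    if "finite S" "finite T" "card S = card T" for S T
    using exists_bij_image_eq[OF that] card_actions_image_le[OF assms(1) that(1)] by metis
  then show ?thesis using assms by (metis le_antisym)
qed

section \<open>Points with a prescribed stabilizer\<close>

definition stabilizer_pairs :: "nat set \<Rightarrow> 'a set \<Rightarrow> (('a \<Rightarrow> nat \<Rightarrow> nat) \<times> nat) set" where
  "stabilizer_pairs S H = {(\<phi>, x). \<phi> \<in> actions G S \<and> x \<in> S \<and> {g \<in> carrier G. \<phi> g x = x} = H}"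

definition coset_embeddings :: "nat set \<Rightarrow> 'a set \<Rightarrow> ('a set \<Rightarrow> nat) set" where
  "coset_embeddings S H = {e \<in> (lcosets H) \<rightarrow>\<^sub>E S. inj_on e (lcosets H)}"

definition equivariant_actions :: "nat set \<Rightarrow> 'a set \<Rightarrow> ('a set \<Rightarrow> nat) \<Rightarrow> ('a \<Rightarrow> nat \<Rightarrow> nat) set" where
  "equivariant_actions S H e =
     {\<phi> \<in> actions G S. \<forall>g\<in>carrier G. \<forall>C\<in>lcosets H. \<phi> g (e C) = e (g <# C)}"

lemma lcosetsE:
  assumes "C \<in> lcosets H"
  obtains a where "a \<in> carrier G" "C = a <# H"
  using assms by (auto simp: LCOSETS_def)

lemma lcosetsI: "a \<in> carrier G \<Longrightarrow> a <# H \<in> lcosets H"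
  by (auto simp: LCOSETS_def)

lemma lcoset_eq_iff:
  assumes "subgroup H G" "a \<in> carrier G" "b \<in> carrier G"
  shows "a <# H = b <# H \<longleftrightarrow> inv a \<otimes> b \<in> H"
  using assms
  by (metis group_axioms l_repr_independence lcos_self subgroup.lcos_module_imp subgroup.lcos_module_rev)

lemma mult_lcoset:
  assumes "subgroup H G" "g \<in> carrier G" "C \<in> lcosets H"
  shows "g <# C \<in> lcosets H"
  using assms by (auto elim!: lcosetsE simp: lcos_m_assoc subgroup.subset intro!: lcosetsI)

lemma mult_lcoset_mult:
  assumes "subgroup H G" "g \<in> carrier G" "h \<in> carrier G" "C \<in> lcosets H"
  shows "(g \<otimes> h) <# C = g <# (h <# C)"
  using assms by (auto elim!: lcosetsE simp: lcos_m_assoc subgroup.subset m_assoc)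

lemma one_lcoset:
  assumes "subgroup H G" "C \<in> lcosets H"
  shows "\<one> <# C = C"
  using assms by (auto elim!: lcosetsE simp: lcos_m_assoc subgroup.subset)

text \<open>
  A point with stabilizer \<^term>\<open>H\<close> amounts to an equivariant embedding of the left cosets
  of \<^term>\<open>H\<close>, namely the orbit map of the point.
\<close>

lemma bij_betw_stabilizer_pairs:
  assumes H: "subgroup H G"
  shows "bij_betw (\<lambda>(e, \<phi>). (\<phi>, e H))
    (SIGMA e:coset_embeddings S H. equivariant_actions S H e) (stabilizer_pairs S H)"
proof -
  have H_coset: "H = \<one> <# H" using H by (simp add: lcos_mult_one subgroup.subset)
  then have H_mem: "H \<in> lcosets H" using lcosetsI[of \<one> H] by simp
  have eq_H: "g <# H = H \<longleftrightarrow> g \<in> H" if "g \<in> carrier G" for g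
    using lcoset_eq_iff[OF H one_closed that] H_coset that by auto
  let ?f = "\<lambda>(e, \<phi>). (\<phi>, e H)" and ?D = "SIGMA e:coset_embeddings S H. equivariant_actions S H e"
  have "inj_on ?f ?D"
  proof (rule inj_onI, clarsimp)
    fix e \<phi> e'
    assume e: "e \<in> coset_embeddings S H" "e' \<in> coset_embeddings S H"
      and \<phi>: "\<phi> \<in> equivariant_actions S H e" "\<phi> \<in> equivariant_actions S H e'"
      and eq: "e H = e' H"
    show "e = e'"
    proof
      fix C
      show "e C = e' C"
      proof (cases "C \<in> lcosets H")
        case True
        then obtain g where g: "g \<in> carrier G" "C = g <# H" by (rule lcosetsE)
        then have "e C = \<phi> g (e H)" "e' C = \<phi> g (e' H)"
          using \<phi> H_mem by (auto simp: equivariant_actions_def)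
        then show ?thesis using eq by simp
      qed (use e in \<open>auto simp: coset_embeddings_def PiE_def extensional_def\<close>)
    qed
  qed
  moreover have "?f ` ?D \<subseteq> stabilizer_pairs S H"
  proof clarsimp
    fix e \<phi> assume e: "e \<in> coset_embeddings S H" and \<phi>: "\<phi> \<in> equivariant_actions S H e"
    have "\<phi> g (e H) = e H \<longleftrightarrow> g \<in> H" if g: "g \<in> carrier G" for g
    proof -
      have "\<phi> g (e H) = e (g <# H)" using \<phi> g H_mem by (auto simp: equivariant_actions_def)
      moreover have "e (g <# H) = e H \<longleftrightarrow> g <# H = H"
        using e H_mem lcosetsI[OF g, of H] by (auto simp: coset_embeddings_def dest: inj_onD)
      ultimately show ?thesis using eq_H[OF g] by simp
    qed
    then have "{g \<in> carrier G. \<phi> g (e H) = e H} = H" using subgroup.subset[OF H] by blast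
    then show "(\<phi>, e H) \<in> stabilizer_pairs S H"
      using e \<phi> H_mem by (auto simp: stabilizer_pairs_def equivariant_actions_def coset_embeddings_def)
  qed
  moreover have "stabilizer_pairs S H \<subseteq> ?f ` ?D"
  proof clarify
    fix \<phi> x assume "(\<phi>, x) \<in> stabilizer_pairs S H"
    then have \<phi>: "\<phi> \<in> actions G S" and x: "x \<in> S" and stab: "{g \<in> carrier G. \<phi> g x = x} = H"
      by (auto simp: stabilizer_pairs_def)
    \<comment> \<open>The orbit map sending gH to g x. The choice of a representative is immaterial
      because H fixes x; injectivity uses that H is the full stabilizer.\<close>
    define e where "e = (\<lambda>C\<in>lcosets H. \<phi> (SOME g. g \<in> C) x)"
    have e: "e (g <# H) = \<phi> g x" if g: "g \<in> carrier G" for g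
    proof -
      let ?g = "SOME h. h \<in> g <# H"
      have "?g \<in> g <# H" using lcos_self[OF g H] by (rule someI)
      then obtain h where h: "h \<in> H" "?g = g \<otimes> h" by (auto simp: l_coset_def)
      have h': "h \<in> carrier G" "\<phi> h x = x" using h(1) stab by auto
      have "e (g <# H) = \<phi> ?g x" using lcosetsI[OF g] by (simp add: e_def)
      also have "\<dots> = \<phi> g (\<phi> h x)" unfolding h(2) by (rule action_mult[OF \<phi> g h'(1)])
      finally show ?thesis using h'(2) by simp
    qed
    have "inj_on e (lcosets H)"
    proof (rule inj_onI)
      fix C D assume CD: "C \<in> lcosets H" "D \<in> lcosets H" and eq: "e C = e D"
      obtain a b where ab: "a \<in> carrier G" "b \<in> carrier G" "C = a <# H" "D = b <# H"
        using CD by (metis lcosetsE)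
      have "\<phi> (inv a \<otimes> b) x = \<phi> (inv a) (\<phi> b x)" using ab by (intro action_mult[OF \<phi>]) auto
      also have "\<dots> = x" using eq ab by (simp add: action_inv_eq_iff[OF \<phi>] e)
      finally have "inv a \<otimes> b \<in> H" using stab ab by blast
      then show "C = D" using ab H by (simp add: lcoset_eq_iff)
    qed
    moreover have "e \<in> (lcosets H) \<rightarrow>\<^sub>E S"
    proof (rule PiE_I)
      fix C assume "C \<in> lcosets H"
      then obtain g where g: "g \<in> carrier G" "C = g <# H" by (rule lcosetsE)
      then show "e C \<in> S" using x permutes_in_image[OF actionsD(1)[OF \<phi> g(1)]] by (simp add: e)
    qed (simp add: e_def)
    moreover have "\<phi> g (e C) = e (g <# C)" if g: "g \<in> carrier G" and C: "C \<in> lcosets H" for g C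
    proof -
      obtain a where a: "a \<in> carrier G" "C = a <# H" using C by (rule lcosetsE)
      then have "g <# C = (g \<otimes> a) <# H" using g H by (simp add: lcos_m_assoc subgroup.subset)
      then show ?thesis using a g by (simp add: e action_mult[OF \<phi>])
    qed
    ultimately have "(e, \<phi>) \<in> ?D"
      using \<phi> by (simp add: coset_embeddings_def equivariant_actions_def)
    moreover have "?f (e, \<phi>) = (\<phi>, x)"
      using e[OF one_closed] by (simp add: action_one[OF \<phi>] flip: H_coset)
    ultimately show "(\<phi>, x) \<in> ?f ` ?D" by (metis imageI)
  qed
  ultimately show ?thesis by (auto simp: bij_betw_def)
qed

text \<open>On the complement of the embedded cosets the action is arbitrary.\<close>

lemma bij_betw_equivariant_actions:
  assumes H: "subgroup H G" and e: "e \<in> coset_embeddings S H"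
  shows "bij_betw (\<lambda>\<phi>. \<lambda>g\<in>carrier G. \<lambda>y. if y \<in> e ` (lcosets H) then y else \<phi> g y)
    (equivariant_actions S H e) (actions G (S - e ` (lcosets H)))"
proof -
  define B where "B = e ` (lcosets H)"
  have inj: "inj_on e (lcosets H)" and BS: "B \<subseteq> S"
    using e by (auto simp: coset_embeddings_def B_def)
  \<comment> \<open>Left translation of cosets, carried to B by \<open>e\<close> and extended by the
    identity. Every member of \<open>equivariant_actions\<close> is forced to act on B in this
    way.\<close>
  define \<alpha> where "\<alpha> g y = (if y \<in> B then e (g <# the_inv_into (lcosets H) e y) else y)" for g y
  have \<alpha>_e: "\<alpha> g (e C) = e (g <# C)" if "C \<in> lcosets H" for g C
    using that by (simp add: \<alpha>_def B_def the_inv_into_f_f[OF inj])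
  have \<alpha>_out: "\<alpha> g y = y" if "y \<notin> B" for g y using that by (simp add: \<alpha>_def)
  have \<alpha>_B: "\<alpha> g y \<in> B" if "g \<in> carrier G" "y \<in> B" for g y
    using that mult_lcoset[OF H] by (auto simp: B_def \<alpha>_e)
  have \<alpha>_mult: "\<alpha> (g \<otimes> h) y = \<alpha> g (\<alpha> h y)" if "g \<in> carrier G" "h \<in> carrier G" for g h y
  proof (cases "y \<in> B")
    case True
    then obtain C where "C \<in> lcosets H" "y = e C" by (auto simp: B_def)
    then show ?thesis using that H by (simp add: \<alpha>_e mult_lcoset mult_lcoset_mult)
  qed (simp add: \<alpha>_out)
  have \<alpha>_one: "\<alpha> \<one> y = y" for y
  proof (cases "y \<in> B")
    case True
    then obtain C where "C \<in> lcosets H" "y = e C" by (auto simp: B_def)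
    then show ?thesis using H by (simp add: \<alpha>_e one_lcoset)
  qed (simp add: \<alpha>_out)
  have \<alpha>_permutes: "\<alpha> g permutes S" if g: "g \<in> carrier G" for g
  proof -
    have "\<alpha> g permutes B"
      unfolding permutes_def
    proof (intro conjI allI impI ex1I)
      fix y
      show "\<alpha> g (\<alpha> (inv g) y) = y" using g by (simp add: \<alpha>_one flip: \<alpha>_mult)
      fix x assume "\<alpha> g x = y"
      then have "\<alpha> (inv g) y = \<alpha> (inv g \<otimes> g) x" using g \<alpha>_mult[of "inv g" g x] by simp
      then show "x = \<alpha> (inv g) y" using g by (simp add: \<alpha>_one)
    qed (rule \<alpha>_out)
    then show ?thesis using BS by (rule permutes_subset)
  qed
  let ?F = "\<lambda>\<phi>. \<lambda>g\<in>carrier G. \<lambda>y. if y \<in> B then y else \<phi> g y"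
  let ?K = "\<lambda>\<psi>. \<lambda>g\<in>carrier G. \<lambda>y. if y \<in> B then \<alpha> g y else \<psi> g y"
  have eqB: "\<phi> g y = \<alpha> g y" if "\<phi> \<in> equivariant_actions S H e" "g \<in> carrier G" "y \<in> B" for \<phi> g y
    using that by (auto simp: equivariant_actions_def B_def \<alpha>_e)
  \<comment> \<open>The complement of B is invariant as well: the inverse of g would bring an image
    in B back into B.\<close>
  have notB: "\<phi> g y \<notin> B" if \<phi>: "\<phi> \<in> equivariant_actions S H e" and g: "g \<in> carrier G" and y: "y \<notin> B"
    for \<phi> g y
  proof
    assume "\<phi> g y \<in> B"
    then have "\<phi> (inv g) (\<phi> g y) \<in> B" using \<phi> g by (simp add: eqB \<alpha>_B)
    moreover have "\<phi> (inv g) (\<phi> g y) = y"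
      using \<phi> g by (auto simp: action_inv_eq_iff equivariant_actions_def)
    ultimately show False using y by simp
  qed
  have notB': "\<psi> g y \<notin> B" if \<psi>: "\<psi> \<in> actions G (S - B)" and g: "g \<in> carrier G" and y: "y \<notin> B" for \<psi> g y
    using permutes_in_image[OF actionsD(1)[OF \<psi> g], of y] permutes_not_in[OF actionsD(1)[OF \<psi> g], of y] y
    by (cases "y \<in> S") auto
  have "bij_betw ?F (equivariant_actions S H e) (actions G (S - B))"
  proof (rule bij_betw_byWitness[of _ ?K])
    show "\<forall>\<phi>\<in>equivariant_actions S H e. ?K (?F \<phi>) = \<phi>"
    proof (intro ballI ext)
      fix \<phi> g y assume \<phi>: "\<phi> \<in> equivariant_actions S H e"
      then have "\<phi> \<in> actions G S" by (simp add: equivariant_actions_def)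
      then show "?K (?F \<phi>) g y = \<phi> g y"
        by (cases "g \<in> carrier G") (simp_all add: actionsD(2) eqB[OF \<phi>])
    qed
    show "\<forall>\<psi>\<in>actions G (S - B). ?F (?K \<psi>) = \<psi>"
    proof (intro ballI ext)
      fix \<psi> g y assume \<psi>: "\<psi> \<in> actions G (S - B)"
      have "g \<in> carrier G \<Longrightarrow> y \<in> B \<Longrightarrow> \<psi> g y = y"
        using permutes_not_in[OF actionsD(1)[OF \<psi>]] by blast
      then show "?F (?K \<psi>) g y = \<psi> g y"
        by (cases "g \<in> carrier G") (simp_all add: actionsD(2)[OF \<psi>])
    qed
    show "?F ` equivariant_actions S H e \<subseteq> actions G (S - B)"
    proof (rule image_subsetI, rule actionsI)
      fix \<phi> g assume \<phi>: "\<phi> \<in> equivariant_actions S H e" and g: "g \<in> carrier G"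
      then have \<phi>': "\<phi> g permutes S" by (auto simp: equivariant_actions_def intro: actionsD(1))
      have "\<alpha> (inv g) \<circ> \<phi> g permutes S" using g by (intro permutes_compose \<phi>' \<alpha>_permutes) simp
      \<comment> \<open>Undoing the forced part by \<alpha> exhibits the restricted map as a
        composition of permutations.\<close>
      moreover have "?F \<phi> g = \<alpha> (inv g) \<circ> \<phi> g"
      proof
        fix y
        show "?F \<phi> g y = (\<alpha> (inv g) \<circ> \<phi> g) y"
          using g by (simp add: \<alpha>_out notB[OF \<phi> g] eqB[OF \<phi> g] \<alpha>_one flip: \<alpha>_mult)
      qed
      ultimately have "?F \<phi> g permutes S" by (simp only:)
      then show "?F \<phi> g permutes S - B" by (rule permutes_superset) (use g in auto)
    next
      fix \<phi> g h assume \<phi>: "\<phi> \<in> equivariant_actions S H e" and gh: "g \<in> carrier G" "h \<in> carrier G"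
      then have "\<phi> \<in> actions G S" by (simp add: equivariant_actions_def)
      then show "?F \<phi> (g \<otimes> h) = ?F \<phi> g \<circ> ?F \<phi> h"
        using gh by (simp add: fun_eq_iff action_mult notB[OF \<phi>])
    qed simp
    show "?K ` actions G (S - B) \<subseteq> equivariant_actions S H e"
    proof (rule image_subsetI)
      fix \<psi> assume \<psi>: "\<psi> \<in> actions G (S - B)"
      have "?K \<psi> \<in> actions G S"
      proof (rule actionsI)
        fix g assume g: "g \<in> carrier G"
        have "\<psi> g permutes S" using actionsD(1)[OF \<psi> g] by (rule permutes_subset) blast
        then have "\<alpha> g \<circ> \<psi> g permutes S" using g by (intro permutes_compose \<alpha>_permutes)
        moreover have "?K \<psi> g = \<alpha> g \<circ> \<psi> g"
        proof
          fix y
          have "y \<in> B \<Longrightarrow> \<psi> g y = y" using permutes_not_in[OF actionsD(1)[OF \<psi> g]] by blast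
          then show "?K \<psi> g y = (\<alpha> g \<circ> \<psi> g) y"
            using g by (simp add: \<alpha>_out notB'[OF \<psi> g])
        qed
        ultimately show "?K \<psi> g permutes S" by (simp only:)
      next
        fix g h assume gh: "g \<in> carrier G" "h \<in> carrier G"
        then show "?K \<psi> (g \<otimes> h) = ?K \<psi> g \<circ> ?K \<psi> h"
          by (simp add: fun_eq_iff action_mult[OF \<psi>] \<alpha>_mult \<alpha>_B notB'[OF \<psi>])
      qed simp
      then show "?K \<psi> \<in> equivariant_actions S H e"
        by (auto simp: equivariant_actions_def \<alpha>_e B_def)
    qed
  qed
  then show ?thesis unfolding B_def .
qed

end

text \<open>The first factor counts the injections of the cosets into S, the second the actions on
  the remaining points, whose number does not depend on the embedding. If the index exceeds
  \<open>card S\<close>, the product contains the factor 0, so truncated subtraction does no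
  harm.\<close>

lemma (in group) card_stabilizer_pairs:
  assumes fin: "finite (carrier G)" "finite S" and H: "subgroup H G"
  shows "card (stabilizer_pairs S H)
    = (\<Prod>i<card (lcosets H). card S - i) * card (actions G {1..card S - card (lcosets H)})"
proof -
  have fin_L: "finite (lcosets H)" using fin(1) by (simp add: LCOSETS_def)
  have fin_E: "finite (coset_embeddings S H)"
    unfolding coset_embeddings_def
    by (rule finite_subset[OF _ finite_PiE[OF fin_L, of "\<lambda>_. S"]]) (use fin in auto)
  have card: "card (equivariant_actions S H e) = card (actions G {1..card S - card (lcosets H)})"
    if e: "e \<in> coset_embeddings S H" for e
  proof -
    have "e ` (lcosets H) \<subseteq> S" "card (e ` (lcosets H)) = card (lcosets H)"
      using e by (auto simp: coset_embeddings_def card_image)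
    then have "card (S - e ` (lcosets H)) = card S - card (lcosets H)"
      using fin_L by (simp add: card_Diff_subset)
    then have "card (actions G (S - e ` (lcosets H))) = card (actions G {1..card S - card (lcosets H)})"
      using fin by (intro card_actions_eq) simp_all
    then show ?thesis
      using bij_betw_same_card[OF bij_betw_equivariant_actions[OF H e]] by simp
  qed
  have "finite (equivariant_actions S H e)" for e
    by (rule finite_subset[OF _ finite_actions[OF fin]]) (auto simp: equivariant_actions_def)
  then have "card (SIGMA e:coset_embeddings S H. equivariant_actions S H e)
    = card (coset_embeddings S H) * card (actions G {1..card S - card (lcosets H)})"
    using fin_E by (simp add: card card_SigmaI)
  moreover have "card (coset_embeddings S H) = (\<Prod>i<card (lcosets H). card S - i)"
    unfolding coset_embeddings_def
    using card_inj_on_subset_funcset[OF fin_L fin(2), of "lcosets H"]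
    by (simp add: atLeast0LessThan)
  ultimately show ?thesis
    using bij_betw_same_card[OF bij_betw_stabilizer_pairs[OF H, of S]] by simp
qed

section \<open>Fixed points sorted by their stabilizers\<close>

lemma (in group) subgroup_stabilizer:
  assumes \<phi>: "\<phi> \<in> actions G S"
  shows "subgroup {g \<in> carrier G. \<phi> g x = x} G"
proof (rule subgroupI)
  show "{g \<in> carrier G. \<phi> g x = x} \<noteq> {}" using action_one[OF \<phi>] by auto
qed (auto simp: action_mult[OF \<phi>] action_inv_eq_iff[OF \<phi>])

lemma (in group) finite_subgroups:
  assumes "finite (carrier G)"
  shows "finite {H. subgroup H G \<and> P H}"
  by (rule finite_subset[of _ "Pow (carrier G)"]) (use assms subgroup.subset in auto)

text \<open>A point is fixed by x exactly if its stabilizer contains x, so the pairs of an action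
  and a fixed point split disjointly according to the stabilizer.\<close>

lemma (in group) sum_fix_count:
  assumes fin: "finite (carrier G)" and x: "x \<in> carrier G"
  shows "(\<Sum>\<phi>\<in>actions G {1..N}. fix_count x N \<phi>)
    = (\<Sum>H | subgroup H G \<and> x \<in> H. card (stabilizer_pairs {1..N} H))"
proof -
  have fin_A: "finite (actions G {1..N})" using fin by (simp add: finite_actions)
  have "(\<Sum>\<phi>\<in>actions G {1..N}. fix_count x N \<phi>)
      = card (SIGMA \<phi>:actions G {1..N}. {y \<in> {1..N}. \<phi> x y = y})"
    using fin_A by (simp add: card_SigmaI fix_count_def)
  also have "(SIGMA \<phi>:actions G {1..N}. {y \<in> {1..N}. \<phi> x y = y})
      = (\<Union>H\<in>{H. subgroup H G \<and> x \<in> H}. stabilizer_pairs {1..N} H)"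
    using x by (auto simp: stabilizer_pairs_def intro: subgroup_stabilizer)
  also have "card \<dots> = (\<Sum>H | subgroup H G \<and> x \<in> H. card (stabilizer_pairs {1..N} H))"
  proof (rule card_UN_disjoint)
    show "\<forall>H\<in>{H. subgroup H G \<and> x \<in> H}. finite (stabilizer_pairs {1..N} H)"
      by (auto simp: stabilizer_pairs_def intro!: finite_subset[OF _ finite_cartesian_product[OF fin_A, of "{1..N}"]])
  qed (use fin finite_subgroups in \<open>auto simp: stabilizer_pairs_def\<close>)
  finally show ?thesis .
qed

text \<open>Division by N! cancels the falling factorial in \<open>card_stabilizer_pairs\<close>, so
  that the counts become plain shifts of this sequence.\<close>

definition (in group) normalized_count :: "nat \<Rightarrow> real" where
  "normalized_count N = real (card (actions G {1..N})) / fact N"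

lemma (in group) actions_nonempty: "actions G S \<noteq> {}"
proof -
  have "(\<lambda>g\<in>carrier G. id) \<in> actions G S" by (rule actionsI) (auto simp: permutes_id)
  then show ?thesis by blast
qed

lemma (in group) fix_count_one:
  assumes "\<phi> \<in> actions G {1..N}"
  shows "fix_count \<one> N \<phi> = N"
proof -
  have "{x \<in> {1..N}. \<phi> \<one> x = x} = {1..N}" using action_one[OF assms] by auto
  then show ?thesis by (simp only: fix_count_def card_atLeastAtMost diff_Suc_1)
qed

lemma expected_fix_eq_sum:
  assumes "group K" "finite (perm_reps K N)"
  shows "expected_fix K x N = (\<Sum>\<phi>\<in>perm_reps K N. real (fix_count x N \<phi>)) / card (perm_reps K N)"
  unfolding expected_fix_def
  by (rule integral_pmf_of_set)
     (use assms group.actions_nonempty in \<open>auto simp: perm_reps_eq_actions\<close>)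

lemma prod_diff_eq_fact_div:
  assumes "m \<le> N"
  shows "real (\<Prod>i<m. N - i) = fact N / fact (N - m)"
  using assms
proof (induction m)
  case (Suc m)
  then have "N - m = Suc (N - Suc m)" by simp
  then have "(fact (N - m) :: real) = real (N - m) * fact (N - Suc m)"
    by (metis fact_Suc of_nat_fact of_nat_mult)
  then show ?case using Suc by (simp add: divide_simps)
qed simp

lemma (in group) normalized_stabilizer_pairs:
  assumes fin: "finite (carrier G)" and H: "subgroup H G"
  shows "real (card (stabilizer_pairs {1..N} H)) / fact N
    = (if card (lcosets H) \<le> N then normalized_count (N - card (lcosets H)) else 0)"
proof (cases "card (lcosets H) \<le> N")
  case True
  then show ?thesis
    by (simp add: card_stabilizer_pairs[OF fin _ H] prod_diff_eq_fact_div normalized_count_def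
             del: of_nat_prod)
next
  case False
  then have "(\<Prod>i<card (lcosets H). N - i) = 0" by (auto intro!: bexI[of _ N])
  then show ?thesis using False by (simp add: card_stabilizer_pairs[OF fin _ H])
qed

locale finite_group = group G for G :: "'a monoid" (structure) +
  assumes finite_carrier: "finite (carrier G)"
begin

lemma card_lcosets_mult: "subgroup H G \<Longrightarrow> card (lcosets H) * card H = card (carrier G)"
  using l_lagrange finite_carrier by (simp add: Coset.order_def)

lemma card_carrier_pos: "card (carrier G) > 0"
  using finite_carrier by (auto simp: card_gt_0_iff)

text \<open>The recurrence is \<open>sum_fix_count\<close> for the identity: it fixes all N points
  under every action and lies in every subgroup.\<close>

lemma orbit_recurrence_subgroups:
  "orbit_recurrence {H. subgroup H G} (\<lambda>H. card (lcosets H)) normalized_count"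
proof
  show "finite {H. subgroup H G}" using finite_subgroups[OF finite_carrier, of "\<lambda>_. True"] by simp
  show "card (lcosets H) > 0" if "H \<in> {H. subgroup H G}" for H
    using card_lcosets_mult[of H] that card_carrier_pos by (cases "card (lcosets H)") auto
  \<comment> \<open>The set {1..0} is empty, so the identity is its only permutation and there is
    exactly one action.\<close>
  have "actions G {1..0} = {\<lambda>g\<in>carrier G. id}"
  proof
    show "actions G {1..0} \<subseteq> {\<lambda>g\<in>carrier G. id}"
      using actionsD(1,2)[of _ G "{}"] by (auto simp: restrict_def fun_eq_iff)
    show "{\<lambda>g\<in>carrier G. id} \<subseteq> actions G {1..0}" by (auto intro!: actionsI permutes_id)
  qed
  then show "normalized_count 0 = 1" by (simp add: normalized_count_def)
  show "\<exists>H\<in>{H. subgroup H G}. card (lcosets H) = 1"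
    using card_lcosets_mult[OF subgroup_self] card_carrier_pos subgroup_self by auto
  fix N
  have "N * card (actions G {1..N}) = (\<Sum>H | subgroup H G \<and> \<one> \<in> H. card (stabilizer_pairs {1..N} H))"
    using sum_fix_count[OF finite_carrier one_closed, of N] by (simp add: fix_count_one mult.commute)
  then have "real N * normalized_count N
      = (\<Sum>H | subgroup H G \<and> \<one> \<in> H. real (card (stabilizer_pairs {1..N} H)) / fact N)"
    unfolding normalized_count_def sum_divide_distrib[symmetric]
    by (simp flip: of_nat_sum of_nat_mult)
  also have "\<dots> = (\<Sum>H | subgroup H G.
      if card (lcosets H) \<le> N then normalized_count (N - card (lcosets H)) else 0)"
  proof (rule sum.cong)
    show "{H. subgroup H G \<and> \<one> \<in> H} = {H. subgroup H G}" by (auto simp: subgroup.one_closed)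
  qed (rule normalized_stabilizer_pairs[OF finite_carrier], simp)
  finally show "real N * normalized_count N = (\<Sum>H | subgroup H G.
      if card (lcosets H) \<le> N then normalized_count (N - card (lcosets H)) else 0)" .
qed

interpretation orbits: orbit_recurrence_top "{H. subgroup H G}" "\<lambda>H. card (lcosets H)"
  normalized_count "card (carrier G)" "{\<one>}"
proof -
  interpret orbit_recurrence "{H. subgroup H G}" "\<lambda>H. card (lcosets H)" normalized_count
    by (rule orbit_recurrence_subgroups)
  show "orbit_recurrence_top {H. subgroup H G} (\<lambda>H. card (lcosets H)) normalized_count (card (carrier G)) {\<one>}"
  proof
    show "{\<one>} \<in> {H. subgroup H G}" by (simp add: triv_subgroup)
    show "card (lcosets {\<one>}) = card (carrier G)" using card_lcosets_mult[OF triv_subgroup] by simp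
    fix H assume H: "H \<in> {H. subgroup H G}"
    then have eq: "card (lcosets H) * card H = card (carrier G)" by (simp add: card_lcosets_mult)
    then show "card (lcosets H) dvd card (carrier G)" by (metis dvd_triv_left)
    assume "card (lcosets H) = card (carrier G)"
    then have "card H = 1" using eq card_carrier_pos by simp
    then show "H = {\<one>}" using H by (auto simp: card_1_singleton_iff dest: subgroup.one_closed)
  qed
qed

lemma expected_fix_eq_sum_ratio:
  assumes x: "x \<in> carrier G"
  shows "expected_fix G x N = (\<Sum>H | subgroup H G \<and> x \<in> H. orbits.ratio (card (lcosets H)) N)"
proof -
  have fin_A: "finite (actions G {1..N})" using finite_carrier by (simp add: finite_actions)
  have "expected_fix G x N = (\<Sum>\<phi>\<in>actions G {1..N}. real (fix_count x N \<phi>)) / card (actions G {1..N})"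
    using expected_fix_eq_sum[OF group_axioms] fin_A by (simp add: perm_reps_eq_actions)
  also have "\<dots> = (\<Sum>H | subgroup H G \<and> x \<in> H. real (card (stabilizer_pairs {1..N} H)) / fact N)
      / normalized_count N"
    using sum_fix_count[OF finite_carrier x, of N]
    by (simp add: normalized_count_def flip: sum_divide_distrib of_nat_sum)
  also have "\<dots> = (\<Sum>H | subgroup H G \<and> x \<in> H. orbits.ratio (card (lcosets H)) N)"
    unfolding sum_divide_distrib
  proof (rule sum.cong)
    fix H assume "H \<in> {H. subgroup H G \<and> x \<in> H}"
    then have "real (card (stabilizer_pairs {1..N} H)) / fact N
        = (if card (lcosets H) \<le> N then normalized_count (N - card (lcosets H)) else 0)"
      by (intro normalized_stabilizer_pairs finite_carrier) simp
    then show "real (card (stabilizer_pairs {1..N} H)) / fact N / normalized_count N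
        = orbits.ratio (card (lcosets H)) N"
      unfolding orbits.ratio_def by simp
  qed simp
  finally show ?thesis .
qed

theorem expected_fix_asymptotics:
  assumes x: "x \<in> carrier G"
  shows "(\<lambda>N. expected_fix G x N - real N powr (1 / real (ord x)))
           \<in> O(\<lambda>N. real N powr (1 / (2 * real (ord x))))"
  unfolding expected_fix_eq_sum_ratio[OF x]
proof (rule orbits.sum_ratio_asymptotics)
  let ?C = "generate G {x}"
  have C: "subgroup ?C G" using x by (intro generate_is_subgroup) simp
  have card_C: "card ?C = ord x" using x by (simp add: generate_pow_card)
  have "x \<in> ?C" by (simp add: generate.incl)
  then show "?C \<in> {H. subgroup H G \<and> x \<in> H}" using C by simp
  show "card (carrier G) = ord x * card (lcosets ?C)"
    using card_lcosets_mult[OF C] by (simp add: card_C mult.commute)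
  fix H assume H: "H \<in> {H. subgroup H G \<and> x \<in> H}" "H \<noteq> ?C"
  then have sub: "?C \<subseteq> H" using generate_subgroup_incl[of "{x}" H] by simp
  have fin_H: "finite H" using H finite_carrier finite_subset subgroup.subset by blast
  \<comment> \<open>Lagrange's theorem inside H. As H is strictly larger than \<open>?C\<close>, the
    quotient of the orders is at least 2.\<close>
  have "ord x dvd card H"
  proof -
    interpret H: group "G\<lparr>carrier := H\<rparr>" using H by (simp add: subgroup_imp_group)
    have "subgroup ?C (G\<lparr>carrier := H\<rparr>)" using C H sub by (simp add: subgroup_incl)
    from H.lagrange[OF this] have "card H = card (rcosets\<^bsub>G\<lparr>carrier := H\<rparr>\<^esub> ?C) * ord x"
      by (simp add: card_C Coset.order_def)
    then show ?thesis by simp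
  qed
  then obtain q where q: "card H = ord x * q" by blast
  have "card ?C < card H" using sub H fin_H by (simp add: psubset_card_mono psubset_eq)
  then have "q \<noteq> 0" "q \<noteq> 1" using q card_C by auto
  then have "2 * ord x \<le> card H" unfolding q by (cases q) auto
  then have "2 * ord x * card (lcosets H) \<le> card H * card (lcosets H)" by (rule mult_le_mono1)
  then show "2 * ord x * card (lcosets H) \<le> card (carrier G)"
    using card_lcosets_mult[of H] H by (simp only: mem_Collect_eq mult.commute)
next
  assume "ord x = 1"
  then have "x = \<one>" using x ord_eq_1 by blast
  then show "{H. subgroup H G \<and> x \<in> H} = {H. subgroup H G}"
    using x by (auto simp: subgroup.one_closed)
qed auto

end

section \<open>Torsion in groups given by reduced words\<close>

definition word_eval :: "('b, 'm) monoid_scheme \<Rightarrow> ('l \<Rightarrow> 'b) \<Rightarrow> 'l list \<Rightarrow> 'b" where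
  "word_eval M f w = foldr (\<lambda>a y. f a \<otimes>\<^bsub>M\<^esub> y) w \<one>\<^bsub>M\<^esub>"

lemma word_eval_simps [simp]:
  "word_eval M f [] = \<one>\<^bsub>M\<^esub>"
  "word_eval M f (a # w) = f a \<otimes>\<^bsub>M\<^esub> word_eval M f w"
  by (simp_all add: word_eval_def)

lemma (in monoid) word_eval_closed:
  "f \<in> A \<rightarrow> carrier G \<Longrightarrow> w \<in> lists A \<Longrightarrow> word_eval G f w \<in> carrier G"
  by (induction w) auto

lemma (in monoid) word_eval_append:
  assumes "f \<in> A \<rightarrow> carrier G" "u \<in> lists A" "v \<in> lists A"
  shows "word_eval G f (u @ v) = word_eval G f u \<otimes> word_eval G f v"
  using assms(2)
proof (induction u)
  case (Cons a u)
  then have "u \<in> lists A" "f a \<in> carrier G" using assms(1) by auto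
  then show ?case
    using Cons word_eval_closed[OF assms(1)] assms(3) by (simp add: m_assoc del: in_lists_conv_set)
qed (use assms word_eval_closed[OF assms(1)] in auto)

lemma (in monoid) word_eval_word_cong:
  assumes "(u, v) \<in> word_cong A R" and f: "f \<in> A \<rightarrow> carrier G"
    and "\<And>l r. (l, r) \<in> R \<Longrightarrow> l \<in> lists A \<Longrightarrow> r \<in> lists A \<Longrightarrow> word_eval G f l = word_eval G f r"
  shows "word_eval G f u = word_eval G f v"
  using assms(1)
proof (induction rule: word_cong.induct)
  case (rel l r u v)
  then have "l @ v \<in> lists A" "r @ v \<in> lists A" by simp_all
  then show ?case using rel assms(3) by (simp add: word_eval_append[OF f])
qed simp_all

text \<open>Letters act on W, and the relations are checked on W only. Van der Waerden's argument
  takes this form with W the reduced words, where reducedness is what makes the relations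
  hold.\<close>

lemma word_cong_foldr:
  assumes "(u, v) \<in> word_cong A R"
    and act: "\<And>a w. a \<in> A \<Longrightarrow> w \<in> W \<Longrightarrow> act a w \<in> W"
    and R: "\<And>l r w. (l, r) \<in> R \<Longrightarrow> l \<in> lists A \<Longrightarrow> r \<in> lists A \<Longrightarrow> w \<in> W \<Longrightarrow>
      foldr act l w = foldr act r w"
    and "w \<in> W"
  shows "foldr act u w = foldr act v w"
  using assms(1,4)
proof (induction arbitrary: w rule: word_cong.induct)
  case (rel l r u v)
  have "foldr act v w \<in> W" if "v \<in> lists A" for v using that rel.prems act by (induction v) auto
  then show ?case using rel R by simp
qed simp_all

text \<open>The universal property of a presentation, as a function on classes. The value is
  independent of the chosen representative once f respects the relations.\<close>

definition presented_lift :: "('b, 'm) monoid_scheme \<Rightarrow> ('l \<Rightarrow> 'b) \<Rightarrow> 'l list set \<Rightarrow> 'b" where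
  "presented_lift M f X = word_eval M f (SOME w. w \<in> X)"

lemma (in monoid)
  assumes f: "f \<in> A \<rightarrow> carrier G"
    and R: "\<And>l r. (l, r) \<in> R \<Longrightarrow> l \<in> lists A \<Longrightarrow> r \<in> lists A \<Longrightarrow> word_eval G f l = word_eval G f r"
  shows presented_lift_class:
      "w \<in> lists A \<Longrightarrow> presented_lift G f (word_cong A R `` {w}) = word_eval G f w"
    and presented_lift_hom: "presented_lift G f \<in> hom (presented_monoid A R) G"
proof -
  show lift: "presented_lift G f (word_cong A R `` {w}) = word_eval G f w" if "w \<in> lists A" for w
  proof -
    have "w \<in> word_cong A R `` {w}" using word_cong.refl[OF that] by simp
    then have "(SOME u. u \<in> word_cong A R `` {w}) \<in> word_cong A R `` {w}" by (rule someI)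
    then have "(w, SOME u. u \<in> word_cong A R `` {w}) \<in> word_cong A R" by simp
    from word_eval_word_cong[OF this f R] show ?thesis by (simp add: presented_lift_def)
  qed
  show "presented_lift G f \<in> hom (presented_monoid A R) G"
  proof (rule homI)
    fix X assume "X \<in> carrier (presented_monoid A R)"
    then obtain u where u: "u \<in> lists A" "X = word_cong A R `` {u}"
      by (rule presented_monoid_carrierE)
    then show "presented_lift G f X \<in> carrier G" by (simp add: lift word_eval_closed[OF f])
    fix Y assume "Y \<in> carrier (presented_monoid A R)"
    then obtain v where v: "v \<in> lists A" "Y = word_cong A R `` {v}"
      by (rule presented_monoid_carrierE)
    have "u @ v \<in> lists A" using u v by simp
    then show "presented_lift G f (X \<otimes>\<^bsub>presented_monoid A R\<^esub> Y)
        = presented_lift G f X \<otimes> presented_lift G f Y"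
      unfolding u(2) v(2) presented_monoid_mult[OF u(1) v(1)]
      using u v by (simp only: lift word_eval_append[OF f])
  qed
qed

lemma presented_monoid_class_Cons:
  assumes "a \<in> A" "w \<in> lists A"
  shows "word_cong A R `` {a # w}
    = word_cong A R `` {[a]} \<otimes>\<^bsub>presented_monoid A R\<^esub> word_cong A R `` {w}"
  using presented_monoid_mult[of "[a]" A w R] assms by simp

lemma hom_class_eq_word_eval:
  assumes "group (presented_monoid A R)" "group M" "h \<in> hom (presented_monoid A R) M" "w \<in> lists A"
  shows "h (word_cong A R `` {w}) = word_eval M (\<lambda>a. h (word_cong A R `` {[a]})) w"
  using assms(4)
proof (induction w)
  case Nil
  then show ?case
    using hom_one[OF assms(3,1,2)] by (simp add: presented_monoid_one)
next
  case (Cons a w)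
  then have aw: "[a] \<in> lists A" "a \<in> A" "w \<in> lists A" by simp_all
  show ?case
    unfolding presented_monoid_class_Cons[OF aw(2,3)]
      hom_mult[OF assms(3) presented_monoid_class_in_carrier[OF aw(1)]
        presented_monoid_class_in_carrier[OF aw(3)]]
    by (simp add: Cons.IH)
qed

lemma presented_monoid_pow:
  assumes "w \<in> lists A"
  shows "word_cong A R `` {w} [^]\<^bsub>presented_monoid A R\<^esub> n
    = word_cong A R `` {concat (replicate n w)}"
proof (induction n)
  case (Suc n)
  have "concat (replicate n w) \<in> lists A" using assms by (induction n) auto
  moreover have "concat (replicate n w) @ w = concat (replicate (Suc n) w)"
    by (induction n) simp_all
  ultimately show ?case
    using assms by (simp only: nat_pow_Suc Suc presented_monoid_mult)
qed (simp add: presented_monoid_one)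

lemma successively_concat_replicate:
  assumes "successively P w" "w = [] \<or> P (last w) (hd w)"
  shows "successively P (concat (replicate n w))"
proof (cases "w = []")
  case False
  show ?thesis
  proof (induction n)
    case (Suc n)
    then show ?case using assms False by (cases n) (auto simp: successively_append_iff)
  qed simp
qed (simp add: concat_replicate_trivial)

lemma not_successivelyE:
  assumes "\<not> successively P w"
  obtains u a b v where "w = u @ a # b # v" "\<not> P a b"
  using assms
proof (induction P w arbitrary: thesis rule: successively.induct)
  case (3 P x y xs)
  show ?case
  proof (cases "P x y")
    case True
    then have "\<not> successively P (y # xs)" using "3.prems"(2) by simp
    with "3.IH" True obtain u a b v where "y # xs = u @ a # b # v" "\<not> P a b" by blast
    then show ?thesis using "3.prems"(1)[of "x # u" a b v] by simp
  next
    case False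
    then show ?thesis using "3.prems"(1)[of "[]" x y xs] by simp
  qed
qed simp_all

text \<open>Conjugacy is written x g = g y, so that no inverses occur; by induction x^n g = g y^n,
  and g cancels.\<close>

lemma (in group) pow_eq_one_iff_intertwined:
  assumes "x \<in> carrier G" "y \<in> carrier G" "g \<in> carrier G" "x \<otimes> g = g \<otimes> y"
  shows "x [^] (n::nat) = \<one> \<longleftrightarrow> y [^] n = \<one>"
proof -
  have "x [^] n \<otimes> g = g \<otimes> y [^] n" for n :: nat
  proof (induction n)
    case (Suc n)
    have "x [^] Suc n \<otimes> g = x [^] n \<otimes> (x \<otimes> g)" using assms by (simp add: m_assoc)
    also have "\<dots> = (x [^] n \<otimes> g) \<otimes> y" using assms by (simp add: m_assoc)
    also have "\<dots> = g \<otimes> y [^] Suc n" unfolding Suc using assms by (simp add: m_assoc)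
    finally show ?case .
  qed (use assms in simp)
  from this[of n] show ?thesis
    using assms by (metis l_cancel_one' r_cancel_one' l_one r_one nat_pow_closed)
qed

text \<open>
  \<^term>\<open>clash a b\<close> says that \<^term>\<open>[a, b]\<close> is not reduced. In a conjugacy class of
  elements of finite order a word of minimal length cannot be cyclically reduced, as its powers
  would be reduced; hence it has at most one letter.
\<close>

locale reduced_word_presentation =
  fixes A :: "'l set" and R :: "('l list \<times> 'l list) set" and clash :: "'l \<Rightarrow> 'l \<Rightarrow> bool"
  assumes group: "group (presented_monoid A R)"
    and shorten: "a \<in> A \<Longrightarrow> b \<in> A \<Longrightarrow> clash a b \<Longrightarrow>
      \<exists>w\<in>lists A. ([a, b], w) \<in> word_cong A R \<and> length w < 2"
    and reduced_nontrivial: "w \<in> lists A \<Longrightarrow> length w \<ge> 2 \<Longrightarrow>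
      successively (\<lambda>a b. \<not> clash a b) w \<Longrightarrow> (w, []) \<notin> word_cong A R"
begin

lemma clash_shorten:
  assumes "u @ a # b # v \<in> lists A" "clash a b"
  shows "\<exists>w\<in>lists A. (u @ a # b # v, w) \<in> word_cong A R \<and> length w < length (u @ a # b # v)"
proof -
  have ab: "a \<in> A" "b \<in> A" and uv: "u \<in> lists A" "v \<in> lists A" using assms(1) by auto
  obtain w where w: "w \<in> lists A" "([a, b], w) \<in> word_cong A R" "length w < 2"
    using shorten[OF ab assms(2)] by blast
  have "(u @ [a, b] @ v, u @ w @ v) \<in> word_cong A R"
    by (rule word_cong_context[OF w(2) uv])
  then show ?thesis using w uv by (intro bexI[of _ "u @ w @ v"]) auto
qed

theorem torsion_conjugate_to_letter:
  assumes x: "x \<in> carrier (presented_monoid A R)"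
    and n: "n > 0" "x [^]\<^bsub>presented_monoid A R\<^esub> (n::nat) = \<one>\<^bsub>presented_monoid A R\<^esub>"
  obtains g w where "g \<in> carrier (presented_monoid A R)" "w \<in> lists A"
    and "x \<otimes>\<^bsub>presented_monoid A R\<^esub> g = g \<otimes>\<^bsub>presented_monoid A R\<^esub> word_cong A R `` {w}"
    and "w = [] \<or> (\<exists>a. w = [a] \<and> clash a a)"
proof -
  let ?M = "presented_monoid A R" and ?cls = "\<lambda>w. word_cong A R `` {w}"
  interpret group ?M by (rule group)
  define Q where "Q w \<longleftrightarrow> w \<in> lists A \<and> (\<exists>g\<in>carrier ?M. x \<otimes>\<^bsub>?M\<^esub> g = g \<otimes>\<^bsub>?M\<^esub> ?cls w)" for w
  obtain w0 where "w0 \<in> lists A" "x = ?cls w0" using x by (rule presented_monoid_carrierE)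
  then have "Q w0" using x unfolding Q_def by (intro conjI bexI[of _ "\<one>\<^bsub>?M\<^esub>"]) auto
  then obtain w where w: "Q w" and minimal: "\<And>v. Q v \<Longrightarrow> length w \<le> length v"
    using ex_has_least_nat[of Q w0 length] by blast
  have wA: "w \<in> lists A" using w by (simp add: Q_def)
  obtain g where g: "g \<in> carrier ?M" "x \<otimes>\<^bsub>?M\<^esub> g = g \<otimes>\<^bsub>?M\<^esub> ?cls w"
    using w by (auto simp: Q_def)
  \<comment> \<open>Stated for every word of minimal length conjugate to x, because it serves both
    \<open>w\<close> and the rotation of \<open>w\<close> that moves its first letter to the
    end.\<close>
  have no_clash: "\<not> clash a b" if "Q (u @ a # b # v)" "length (u @ a # b # v) = length w" for u a b v
  proof
    assume "clash a b"
    moreover have "u @ a # b # v \<in> lists A" using that(1) unfolding Q_def by blast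
    ultimately obtain w' where w': "w' \<in> lists A" "(u @ a # b # v, w') \<in> word_cong A R"
        "length w' < length (u @ a # b # v)"
      using clash_shorten by blast
    then have "Q w'" using that(1) presented_monoid_class_eq[OF w'(2)] by (simp add: Q_def)
    then show False using minimal[of w'] w'(3) that(2) by simp
  qed
  have reduced: "successively (\<lambda>a b. \<not> clash a b) w"
  proof (rule ccontr)
    assume "\<not> successively (\<lambda>a b. \<not> clash a b) w"
    then obtain u a b v where "w = u @ a # b # v" "\<not> \<not> clash a b" by (rule not_successivelyE)
    then show False using no_clash w by blast
  qed
  have "w = [] \<or> (\<exists>a. w = [a] \<and> clash a a)"
  proof (rule ccontr)
    assume neg: "\<not> (w = [] \<or> (\<exists>a. w = [a] \<and> clash a a))"
    then obtain a v where av: "w = a # v" by (cases w) auto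
    have "\<not> clash (last w) (hd w)"
    proof (cases "v = []")
      case True
      then show ?thesis using neg av by simp
    next
      case False
      then obtain u b where ub: "v = u @ [b]" by (metis append_butlast_last_id)
      have A: "a \<in> A" "v \<in> lists A" "[a] \<in> lists A" using wA av by auto
      \<comment> \<open>Multiplying the conjugating element by the first letter of the word rotates
        the word.\<close>
      have ga: "g \<otimes>\<^bsub>?M\<^esub> ?cls [a] \<in> carrier ?M"
        using g A presented_monoid_class_in_carrier[of "[a]" A R] by (intro m_closed) auto
      have "x \<otimes>\<^bsub>?M\<^esub> (g \<otimes>\<^bsub>?M\<^esub> ?cls [a]) = g \<otimes>\<^bsub>?M\<^esub> ?cls w \<otimes>\<^bsub>?M\<^esub> ?cls [a]"
        using g x A presented_monoid_class_in_carrier[of _ A R] by (simp flip: m_assoc)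
      also have "\<dots> = g \<otimes>\<^bsub>?M\<^esub> ?cls [a] \<otimes>\<^bsub>?M\<^esub> (?cls v \<otimes>\<^bsub>?M\<^esub> ?cls [a])"
        using g A presented_monoid_class_in_carrier[of _ A R]
        unfolding av presented_monoid_class_Cons[OF A(1,2)] by (simp add: m_assoc)
      also have "?cls v \<otimes>\<^bsub>?M\<^esub> ?cls [a] = ?cls (v @ [a])"
        by (rule presented_monoid_mult) (use A in auto)
      finally have "Q (v @ [a])" using ga A unfolding Q_def by auto
      then have "Q (u @ b # a # [])" by (simp add: ub)
      from no_clash[OF this] show ?thesis by (simp add: av ub)
    qed
    \<comment> \<open>The exponent 2 n, instead of n, guarantees length at least 2 even for a single
      letter and n = 1, as \<open>reduced_nontrivial\<close> demands.\<close>
    then have "successively (\<lambda>a b. \<not> clash a b) (concat (replicate (2 * n) w))"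
      using reduced by (intro successively_concat_replicate) auto
    moreover have "concat (replicate (2 * n) w) \<in> lists A" using wA by auto
    moreover have "length (concat (replicate (2 * n) w)) \<ge> 2"
      using n(1) by (simp add: av length_concat sum_list_replicate)
    ultimately have "(concat (replicate (2 * n) w), []) \<notin> word_cong A R"
      by (intro reduced_nontrivial)
    moreover have "x [^]\<^bsub>?M\<^esub> (2 * n) = \<one>\<^bsub>?M\<^esub>"
      using n(2) x by (simp add: mult.commute[of 2] flip: nat_pow_pow)
    then have "?cls w [^]\<^bsub>?M\<^esub> (2 * n) = \<one>\<^bsub>?M\<^esub>"
      using pow_eq_one_iff_intertwined[OF x presented_monoid_class_in_carrier[OF wA] g] by blast
    then have "?cls (concat (replicate (2 * n) w)) = ?cls []"
      by (simp only: presented_monoid_pow[OF wA] presented_monoid_one)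
    then have "(concat (replicate (2 * n) w), []) \<in> word_cong A R"
      using eq_equiv_class[OF _ equiv_word_cong] by (metis in_listsI empty_iff empty_set)
    ultimately show False by blast
  qed
  then show thesis using that g wA by blast
qed

end

section \<open>Groups presented by generators and relators; free groups\<close>

definition group_relations :: "'g set \<Rightarrow> ('g \<times> bool) list set \<Rightarrow>
    (('g \<times> bool) list \<times> ('g \<times> bool) list) set" where
  "group_relations S R = {([(s, b), (s, \<not> b)], []) | s b. s \<in> S} \<union> {(r, []) | r. r \<in> R}"

definition group_word :: "'g set \<Rightarrow> ('g \<times> bool) list set \<Rightarrow> ('g \<times> bool) list \<Rightarrow> ('g \<times> bool) list set" where
  "group_word S R w = word_cong (S \<times> UNIV) (group_relations S R) `` {w}"

lemma presented_group_eq: "presented_group S R = presented_monoid (S \<times> UNIV) (group_relations S R)"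
  by (simp add: presented_group_def group_relations_def)

lemma group_word_closed: "w \<in> lists (S \<times> UNIV) \<Longrightarrow> group_word S R w \<in> carrier (presented_group S R)"
  unfolding presented_group_eq group_word_def by (rule presented_monoid_class_in_carrier)

lemma group_word_append:
  "u \<in> lists (S \<times> UNIV) \<Longrightarrow> v \<in> lists (S \<times> UNIV) \<Longrightarrow>
    group_word S R (u @ v) = group_word S R u \<otimes>\<^bsub>presented_group S R\<^esub> group_word S R v"
  unfolding presented_group_eq group_word_def by (rule presented_monoid_mult[symmetric])

lemma group_word_Nil: "group_word S R [] = \<one>\<^bsub>presented_group S R\<^esub>"
  unfolding presented_group_eq group_word_def by (rule presented_monoid_one[symmetric])

lemma group_word_carrierE:
  assumes "x \<in> carrier (presented_group S R)"
  obtains w where "w \<in> lists (S \<times> UNIV)" "x = group_word S R w"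
  using assms unfolding presented_group_eq group_word_def by (rule presented_monoid_carrierE)

lemma group_word_relation:
  assumes "(l, r) \<in> group_relations S R" "l \<in> lists (S \<times> UNIV)" "r \<in> lists (S \<times> UNIV)"
  shows "group_word S R l = group_word S R r"
  using presented_monoid_class_eq[OF word_cong.rel[OF assms, of "[]" "[]"]]
  by (simp add: group_word_def)

lemma group_word_relator:
  "r \<in> R \<Longrightarrow> r \<in> lists (S \<times> UNIV) \<Longrightarrow> group_word S R r = \<one>\<^bsub>presented_group S R\<^esub>"
  unfolding group_word_Nil[symmetric] by (rule group_word_relation) (auto simp: group_relations_def)

lemma group_word_inverse_letter:
  assumes "s \<in> S"
  shows "group_word S R [(s, False)] = inv\<^bsub>presented_group S R\<^esub> group_word S R [(s, True)]"
proof -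
  interpret group "presented_group S R" by (rule group_presented_group)
  have l: "[(s, False)] \<in> lists (S \<times> UNIV)" "[(s, True)] \<in> lists (S \<times> UNIV)" using assms by auto
  have "group_word S R ([(s, False)] @ [(s, True)]) = group_word S R []"
    by (rule group_word_relation) (use assms in \<open>force simp: group_relations_def\<close>)+
  then have "group_word S R [(s, False)] \<otimes>\<^bsub>presented_group S R\<^esub> group_word S R [(s, True)]
      = \<one>\<^bsub>presented_group S R\<^esub>"
    unfolding group_word_append[OF l] group_word_Nil .
  then show ?thesis using l by (intro inv_equality[symmetric] group_word_closed)
qed

definition signed_letter :: "('b, 'm) monoid_scheme \<Rightarrow> ('g \<Rightarrow> 'b) \<Rightarrow> 'g \<times> bool \<Rightarrow> 'b" where
  "signed_letter M f = (\<lambda>(s, b). if b then f s else inv\<^bsub>M\<^esub> f s)"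

lemma (in group)
  assumes f: "f \<in> S \<rightarrow> carrier G"
    and R: "\<And>r. r \<in> R \<Longrightarrow> r \<in> lists (S \<times> UNIV) \<Longrightarrow> word_eval G (signed_letter G f) r = \<one>"
  shows presented_group_lift_letter:
      "s \<in> S \<Longrightarrow> presented_lift G (signed_letter G f) (group_word S R [(s, True)]) = f s"
    and presented_group_lift_hom: "presented_lift G (signed_letter G f) \<in> hom (presented_group S R) G"
proof -
  have f': "signed_letter G f \<in> S \<times> UNIV \<rightarrow> carrier G"
    using f by (auto simp: signed_letter_def Pi_iff)
  have R': "word_eval G (signed_letter G f) l = word_eval G (signed_letter G f) r"
    if "(l, r) \<in> group_relations S R" "l \<in> lists (S \<times> UNIV)" "r \<in> lists (S \<times> UNIV)" for l r
    using that(1) unfolding group_relations_def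
  proof
    assume "(l, r) \<in> {([(s, b), (s, \<not> b)], []) | s b. s \<in> S}"
    then show ?thesis using f by (auto simp: signed_letter_def Pi_iff)
  next
    assume "(l, r) \<in> {(r, []) | r. r \<in> R}"
    then show ?thesis using R[OF _ that(2)] by simp
  qed
  show "presented_lift G (signed_letter G f) \<in> hom (presented_group S R) G"
    unfolding presented_group_eq by (rule presented_lift_hom[OF f' R'])
  assume s: "s \<in> S"
  then have "presented_lift G (signed_letter G f) (group_word S R [(s, True)])
      = word_eval G (signed_letter G f) [(s, True)]"
    unfolding group_word_def by (intro presented_lift_class[OF f' R']) simp_all
  then show "presented_lift G (signed_letter G f) (group_word S R [(s, True)]) = f s"
    using f s by (auto simp: signed_letter_def Pi_iff)
qed

text \<open>Van der Waerden's method: the free group acts on the reduced words.\<close>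

definition free_clash :: "'g \<times> bool \<Rightarrow> 'g \<times> bool \<Rightarrow> bool" where
  "free_clash a b \<longleftrightarrow> fst a = fst b \<and> snd a \<noteq> snd b"

fun free_cons :: "'g \<times> bool \<Rightarrow> ('g \<times> bool) list \<Rightarrow> ('g \<times> bool) list" where
  "free_cons a [] = [a]"
| "free_cons a (b # w) = (if free_clash a b then w else a # b # w)"

lemma free_cons_reduced:
  "successively (\<lambda>a b. \<not> free_clash a b) w \<Longrightarrow> successively (\<lambda>a b. \<not> free_clash a b) (free_cons a w)"
  by (cases w) (auto simp: successively_Cons)

text \<open>If the inner step deletes the first letter \<open>(s, b)\<close> of w, the outer step
  restores it, because in a reduced w the next letter is not \<open>(s, \<not> b)\<close>.\<close>

lemma free_cons_cancel:
  "successively (\<lambda>a b. \<not> free_clash a b) w \<Longrightarrow> free_cons (s, b) (free_cons (s, \<not> b) w) = w"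
  by (cases w rule: remdups_adj.cases) (auto simp: free_clash_def prod_eq_iff)

lemma foldr_free_cons_reduced:
  "successively (\<lambda>a b. \<not> free_clash a b) w \<Longrightarrow> foldr free_cons w [] = w"
  by (induction w rule: induct_list012) auto

text \<open>A letter never clashes with itself under \<open>free_clash\<close>, so the word that
  \<open>torsion_conjugate_to_letter\<close> attaches to x is empty.\<close>

lemma free_group_torsion_free:
  assumes x: "x \<in> carrier (free_group S)"
    and n: "n > 0" "x [^]\<^bsub>free_group S\<^esub> (n::nat) = \<one>\<^bsub>free_group S\<^esub>"
  shows "x = \<one>\<^bsub>free_group S\<^esub>"
proof -
  have eq: "free_group S = presented_monoid (S \<times> UNIV) (group_relations S {})"
    by (simp add: free_group_def presented_group_eq)
  interpret group "free_group S" unfolding free_group_def by (rule group_presented_group)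
  interpret P: reduced_word_presentation "S \<times> UNIV" "group_relations S {}" free_clash
  proof (rule reduced_word_presentation.intro)
    show "group (presented_monoid (S \<times> UNIV) (group_relations S {}))"
      using group_axioms by (simp add: eq)
  next
    fix a b :: "'a \<times> bool" assume ab: "a \<in> S \<times> UNIV" "b \<in> S \<times> UNIV" "free_clash a b"
    then have "([a, b], []) \<in> group_relations S {}"
      by (cases a; cases b) (auto simp: free_clash_def group_relations_def)
    from word_cong.rel[OF this, of "S \<times> UNIV" "[]" "[]"] ab
    show "\<exists>w\<in>lists (S \<times> UNIV). ([a, b], w) \<in> word_cong (S \<times> UNIV) (group_relations S {}) \<and> length w < 2"
      by (intro bexI[of _ "[]"]) auto
  next
    fix w :: "('a \<times> bool) list"
    assume w: "length w \<ge> 2" "successively (\<lambda>a b. \<not> free_clash a b) w"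
    show "(w, []) \<notin> word_cong (S \<times> UNIV) (group_relations S {})"
    proof
      assume "(w, []) \<in> word_cong (S \<times> UNIV) (group_relations S {})"
      then have "foldr free_cons w [] = foldr free_cons [] []"
        by (rule word_cong_foldr[where W = "{w. successively (\<lambda>a b. \<not> free_clash a b) w}"])
           (auto simp: group_relations_def free_cons_reduced free_cons_cancel)
      then show False using w by (simp add: foldr_free_cons_reduced)
    qed
  qed
  obtain g w where "g \<in> carrier (free_group S)" "x \<otimes>\<^bsub>free_group S\<^esub> g = g \<otimes>\<^bsub>free_group S\<^esub>
      word_cong (S \<times> UNIV) (group_relations S {}) `` {w}" "w = [] \<or> (\<exists>a. w = [a] \<and> free_clash a a)"
    using P.torsion_conjugate_to_letter x n unfolding eq by metis
  moreover have "w = []" using calculation(3) by (auto simp: free_clash_def)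
  moreover have "word_cong (S \<times> UNIV) (group_relations S {}) `` {[]} = \<one>\<^bsub>free_group S\<^esub>"
    unfolding eq by (rule presented_monoid_one[symmetric])
  ultimately show ?thesis using x by simp
qed

section \<open>Surface groups are torsion-free\<close>

text \<open>
  Let \<^term>\<open>a = Gen_a 1\<close>. The conjugates \<open>a^j s a^-j\<close> of the other generators generate the
  kernel of the homomorphism to the integers counting \<open>a\<close>. Rewriting a word in these
  conjugates, \<^term>\<open>i\<close> is the exponent of \<open>a\<close> accumulated so far and \<^term>\<open>val s j\<close> the
  value given to the \<open>j\<close>-th conjugate of \<open>s\<close>. The relator expresses each conjugate of
  \<open>Gen_b 1\<close> through its neighbour and the conjugates of the remaining generators, so the kernel
  is free on \<open>Gen_b 1\<close> and the latter.
\<close>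

fun height :: "(surface_gen \<times> bool) list \<Rightarrow> int" where
  "height [] = 0"
| "height ((s, e) # w) = (if s = Gen_a 1 then if e then 1 else - 1 else 0) + height w"

fun conjugate_rewrite :: "('b, 'm) monoid_scheme \<Rightarrow> (surface_gen \<Rightarrow> int \<Rightarrow> 'b) \<Rightarrow> int \<Rightarrow>
    (surface_gen \<times> bool) list \<Rightarrow> 'b" where
  "conjugate_rewrite M val i [] = \<one>\<^bsub>M\<^esub>"
| "conjugate_rewrite M val i ((s, e) # w) =
     (if s = Gen_a 1 then conjugate_rewrite M val (if e then i + 1 else i - 1) w
      else (if e then val s i else inv\<^bsub>M\<^esub> val s i) \<otimes>\<^bsub>M\<^esub> conjugate_rewrite M val i w)"

lemma height_append: "height (u @ v) = height u + height v"
  by (induction u rule: height.induct) auto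

lemma height_concat_replicate: "height (concat (replicate n w)) = int n * height w"
  by (induction n) (auto simp: height_append algebra_simps)

lemma conjugate_rewrite_cong:
  assumes "\<And>s j. s \<in> fst ` set w \<Longrightarrow> val s j = val' s j"
  shows "conjugate_rewrite M val i w = conjugate_rewrite M val' i w"
  using assms by (induction M val i w rule: conjugate_rewrite.induct) auto

context group
begin

lemma conjugate_rewrite_closed:
  "(\<And>s j. val s j \<in> carrier G) \<Longrightarrow> conjugate_rewrite G val i w \<in> carrier G"
  by (induction w arbitrary: i rule: height.induct) auto

lemma conjugate_rewrite_append:
  assumes val: "\<And>s j. val s j \<in> carrier G"
  shows "conjugate_rewrite G val i (u @ v)
    = conjugate_rewrite G val i u \<otimes> conjugate_rewrite G val (i + height u) v"
proof (induction u arbitrary: i rule: height.induct)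
  case (2 s e w)
  show ?case
    using val conjugate_rewrite_closed[OF val]
    by (cases "s = Gen_a 1"; cases e) (simp_all add: "2.IH" m_assoc algebra_simps)
qed (use conjugate_rewrite_closed[OF val] in simp)

lemma conjugate_rewrite_concat_replicate:
  assumes val: "\<And>s j. val s j \<in> carrier G" and "height w = 0"
  shows "conjugate_rewrite G val i (concat (replicate n w)) = conjugate_rewrite G val i w [^] n"
proof (induction n)
  case (Suc n)
  have "concat (replicate (Suc n) w) = concat (replicate n w) @ w" by (induction n) simp_all
  then show ?case
    using assms by (simp add: conjugate_rewrite_append height_concat_replicate Suc)
qed simp

end

lemma surface_relator_split:
  assumes "g \<ge> 1"
  obtains r where
    "surface_relator g = [(Gen_a 1, True), (Gen_b 1, True), (Gen_a 1, False), (Gen_b 1, False)] @ r"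
    and "fst ` set r \<subseteq> (Gen_a ` {1..g} \<union> Gen_b ` {1..g}) - {Gen_a 1, Gen_b 1}"
proof
  let ?c = "\<lambda>i. [(Gen_a i, True), (Gen_b i, True), (Gen_a i, False), (Gen_b i, False)]"
  have "[1..<Suc g] = 1 # [2..<Suc g]" using assms upt_conv_Cons[of 1 "Suc g"] by (simp add: numeral_2_eq_2 del: upt_Suc)
  then show "surface_relator g = [(Gen_a 1, True), (Gen_b 1, True), (Gen_a 1, False), (Gen_b 1, False)]
      @ concat (map ?c [2..<Suc g])"
    by (simp add: surface_relator_def)
  show "fst ` set (concat (map ?c [2..<Suc g])) \<subseteq> (Gen_a ` {1..g} \<union> Gen_b ` {1..g}) - {Gen_a 1, Gen_b 1}"
    by auto
qed

text \<open>Two quantities of a word depend only on its class: the exponent sum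
  \<open>height\<close> and the rewritten element of the free group F. A homomorphism h from F
  recovers the class as h (rewriting) a^height. If the n-th power of w is trivial, its height is 0,
  so the rewriting is multiplicative on powers of w; torsion-freeness of F makes it trivial, and
  hence the class too.\<close>

lemma surface_group_torsion_free:
  assumes g: "g \<ge> 1" and x: "x \<in> carrier (surface_group g)"
    and n: "n > 0" "x [^]\<^bsub>surface_group g\<^esub> (n::nat) = \<one>\<^bsub>surface_group g\<^esub>"
  shows "x = \<one>\<^bsub>surface_group g\<^esub>"
proof -
  define S where "S = Gen_a ` {1..g} \<union> Gen_b ` {1..g}"
  define L where "L = surface_group g"
  define F :: "((surface_gen \<times> int) \<times> bool) list set monoid" where "F = free_group UNIV"
  define cls where "cls = group_word S {surface_relator g}"
  have L_eq: "L = presented_group S {surface_relator g}"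
    by (simp add: L_def surface_group_def S_def)
  interpret L: group L unfolding L_eq by (rule group_presented_group)
  interpret F: group F unfolding F_def free_group_def by (rule group_presented_group)
  obtain r where relator: "surface_relator g =
        [(Gen_a 1, True), (Gen_b 1, True), (Gen_a 1, False), (Gen_b 1, False)] @ r"
      and r: "fst ` set r \<subseteq> S - {Gen_a 1, Gen_b 1}"
    using surface_relator_split[OF g] unfolding S_def by blast
  have ab_S: "Gen_a 1 \<in> S" "Gen_b 1 \<in> S" using g by (auto simp: S_def)
  have r_lists: "r \<in> lists (S \<times> UNIV)" using r by auto
  have height_r: "height r = 0"
    using r by (induction r rule: height.induct) auto

  define gen where "gen s j = group_word UNIV {} [((s, j), True)]" for s :: surface_gen and j :: int
  have gen_closed: "gen s j \<in> carrier F" for s j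
    unfolding gen_def F_def free_group_def by (rule group_word_closed) auto
  \<comment> \<open>The j-th conjugate of r, the part of the relator that involves neither
    \<open>Gen_a 1\<close> nor \<open>Gen_b 1\<close>.\<close>
  define \<omega> where "\<omega> j = conjugate_rewrite F gen j r" for j
  have \<omega>_closed: "\<omega> j \<in> carrier F" for j
    unfolding \<omega>_def by (rule F.conjugate_rewrite_closed) (rule gen_closed)
  \<comment> \<open>Rewritten at height j, the relator a b a^-1 b^-1 r becomes \<beta>(j+1)
    \<beta>(j)^-1 \<omega>(j). Equating it to 1 gives a recursion, solved upwards and downwards from
    the free generator at j = 0.\<close>
  define \<beta>p where "\<beta>p = rec_nat (gen (Gen_b 1) 0) (\<lambda>k y. inv\<^bsub>F\<^esub> \<omega> (int k) \<otimes>\<^bsub>F\<^esub> y)"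
  define \<beta>n where "\<beta>n = rec_nat (gen (Gen_b 1) 0) (\<lambda>k y. \<omega> (- int k - 1) \<otimes>\<^bsub>F\<^esub> y)"
  define \<beta> where "\<beta> j = (if j \<ge> 0 then \<beta>p (nat j) else \<beta>n (nat (- j)))" for j
  have \<beta>p_closed: "\<beta>p k \<in> carrier F" for k
    by (induction k) (auto simp: \<beta>p_def gen_closed \<omega>_closed)
  have \<beta>n_closed: "\<beta>n k \<in> carrier F" for k
    by (induction k) (auto simp: \<beta>n_def gen_closed \<omega>_closed)
  have \<beta>_closed: "\<beta> j \<in> carrier F" for j by (simp add: \<beta>_def \<beta>p_closed \<beta>n_closed)
  have \<beta>_0: "\<beta> 0 = gen (Gen_b 1) 0" by (simp add: \<beta>_def \<beta>p_def)
  have \<beta>_step: "\<beta> j = \<omega> j \<otimes>\<^bsub>F\<^esub> \<beta> (j + 1)" for j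
  proof (cases "j \<ge> 0")
    case True
    then have "nat (j + 1) = Suc (nat j)" "int (nat j) = j" by simp_all
    then have "\<beta> (j + 1) = inv\<^bsub>F\<^esub> \<omega> j \<otimes>\<^bsub>F\<^esub> \<beta> j" using True by (simp add: \<beta>_def \<beta>p_def)
    then show ?thesis by (simp add: \<omega>_closed \<beta>_closed flip: F.m_assoc)
  next
    case False
    then have "nat (- j) = Suc (nat (- (j + 1)))" "- int (nat (- (j + 1))) - 1 = j" by simp_all
    then have "\<beta> j = \<omega> j \<otimes>\<^bsub>F\<^esub> \<beta>n (nat (- (j + 1)))" using False by (simp add: \<beta>_def \<beta>n_def)
    moreover have "\<beta>n (nat (- (j + 1))) = \<beta> (j + 1)"
      using False by (cases "j = - 1") (auto simp: \<beta>_def \<beta>n_def \<beta>p_def)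
    ultimately show ?thesis by simp
  qed

  define val where "val s j = (if s = Gen_b 1 then \<beta> j else gen s j)" for s j
  have val_closed: "val s j \<in> carrier F" for s j by (simp add: val_def \<beta>_closed gen_closed)
  note append = F.conjugate_rewrite_append[of val, OF val_closed]
  note closed = F.conjugate_rewrite_closed[of val, OF val_closed]
  have rewrite_r: "conjugate_rewrite F val j r = \<omega> j" for j
    unfolding \<omega>_def by (rule conjugate_rewrite_cong) (use r in \<open>auto simp: val_def\<close>)
  have invariant: "height u = height v \<and> (\<forall>i. conjugate_rewrite F val i u = conjugate_rewrite F val i v)"
    if "(u, v) \<in> word_cong (S \<times> UNIV) (group_relations S {surface_relator g})" for u v
    using that
  proof (induction rule: word_cong.induct)
    case (rel l k u v)
    have "height l = height k \<and> (\<forall>i. conjugate_rewrite F val i l = conjugate_rewrite F val i k)"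
      using rel.hyps(1) unfolding group_relations_def
    proof
      assume "(l, k) \<in> {([(s, b), (s, \<not> b)], []) | s b. s \<in> S}"
      then obtain s b where "l = [(s, b), (s, \<not> b)]" "k = []" by blast
      then show ?thesis by (cases b; cases "s = Gen_a 1") (simp_all add: val_closed)
    next
      assume "(l, k) \<in> {(r, []) | r. r \<in> {surface_relator g}}"
      then have lk: "l = surface_relator g" "k = []" by simp_all
      have "conjugate_rewrite F val i (surface_relator g) = \<one>\<^bsub>F\<^esub>" for i
      proof -
        have "conjugate_rewrite F val i (surface_relator g)
            = \<beta> (i + 1) \<otimes>\<^bsub>F\<^esub> (inv\<^bsub>F\<^esub> \<beta> i \<otimes>\<^bsub>F\<^esub> \<omega> i)"
          unfolding relator by (simp add: rewrite_r val_def)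
        also have "\<dots> = \<one>\<^bsub>F\<^esub>"
          unfolding \<beta>_step[of i]
          by (simp add: F.inv_mult_group F.m_assoc \<omega>_closed \<beta>_closed)
        finally show ?thesis .
      qed
      then show ?thesis using height_r by (simp add: lk relator)
    qed
    then show ?case by (simp add: append height_append)
  qed simp_all

  define a where "a = cls [(Gen_a 1, True)]"
  have cls_closed: "cls w \<in> carrier L" if "w \<in> lists (S \<times> UNIV)" for w
    unfolding cls_def L_eq using that by (rule group_word_closed)
  have cls_append: "cls (u @ v) = cls u \<otimes>\<^bsub>L\<^esub> cls v"
    if "u \<in> lists (S \<times> UNIV)" "v \<in> lists (S \<times> UNIV)" for u v
    unfolding cls_def L_eq using that by (rule group_word_append)
  have cls_letter: "cls [(s, True)] \<in> carrier L" if "s \<in> S" for s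
    using that by (intro cls_closed) simp
  have cls_inverse: "cls [(s, False)] = inv\<^bsub>L\<^esub> cls [(s, True)]" if "s \<in> S" for s
    unfolding cls_def L_eq using that by (rule group_word_inverse_letter)
  have cls_Nil: "cls [] = \<one>\<^bsub>L\<^esub>" unfolding cls_def L_eq by (rule group_word_Nil)
  have a_closed: "a \<in> carrier L" unfolding a_def using ab_S by (intro cls_letter)
  note pow_closed = L.int_pow_closed[OF a_closed]

  \<comment> \<open>The actual conjugates a^j s a^-j in the surface group; the value 1 off S makes f
    total, as F is free on the whole type.\<close>
  define f where "f = (\<lambda>(s, j). if s \<in> S
    then a [^]\<^bsub>L\<^esub> (j::int) \<otimes>\<^bsub>L\<^esub> cls [(s, True)] \<otimes>\<^bsub>L\<^esub> inv\<^bsub>L\<^esub> (a [^]\<^bsub>L\<^esub> j) else \<one>\<^bsub>L\<^esub>)"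
  define h where "h = presented_lift L (signed_letter L f)"
  have f: "f \<in> UNIV \<rightarrow> carrier L"
    by (auto simp: f_def pow_closed cls_letter)
  then have f_closed: "f y \<in> carrier L" for y by blast
  have h_hom: "h \<in> hom F L"
    unfolding h_def F_def free_group_def by (rule L.presented_group_lift_hom[OF f]) simp
  have h_gen: "h (gen s j) = f (s, j)" for s j
    unfolding h_def gen_def by (rule L.presented_group_lift_letter[OF f]) simp_all
  interpret h: group_hom F L h
    by (rule group_hom.intro) (simp_all add: F.group_axioms L.group_axioms group_hom_axioms_def h_hom)
  have conj: "(a [^]\<^bsub>L\<^esub> i \<otimes>\<^bsub>L\<^esub> c \<otimes>\<^bsub>L\<^esub> inv\<^bsub>L\<^esub> (a [^]\<^bsub>L\<^esub> i)) \<otimes>\<^bsub>L\<^esub> (a [^]\<^bsub>L\<^esub> i \<otimes>\<^bsub>L\<^esub> y)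
      = a [^]\<^bsub>L\<^esub> i \<otimes>\<^bsub>L\<^esub> (c \<otimes>\<^bsub>L\<^esub> y)"
    if "c \<in> carrier L" "y \<in> carrier L" for i :: int and c y
    using that pow_closed[of i] by (simp add: L.m_assoc L.inv_solve_left')
  have inv_conj: "inv\<^bsub>L\<^esub> (a [^]\<^bsub>L\<^esub> i \<otimes>\<^bsub>L\<^esub> c \<otimes>\<^bsub>L\<^esub> inv\<^bsub>L\<^esub> (a [^]\<^bsub>L\<^esub> i))
      = a [^]\<^bsub>L\<^esub> i \<otimes>\<^bsub>L\<^esub> inv\<^bsub>L\<^esub> c \<otimes>\<^bsub>L\<^esub> inv\<^bsub>L\<^esub> (a [^]\<^bsub>L\<^esub> i)"
    if "c \<in> carrier L" for i :: int and c
    using that pow_closed[of i] by (simp add: L.m_assoc L.inv_mult_group)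
  \<comment> \<open>Reconstruction of a class from its rewriting, read from left to right with
    starting exponent i. The valuation v is arbitrary, because the identity is applied to
    \<open>gen\<close> on r before it can be applied to \<open>val\<close>.\<close>
  have key: "h (conjugate_rewrite F v i w) \<otimes>\<^bsub>L\<^esub> a [^]\<^bsub>L\<^esub> (i + height w) = a [^]\<^bsub>L\<^esub> i \<otimes>\<^bsub>L\<^esub> cls w"
    if "w \<in> lists (S \<times> UNIV)" and v: "\<And>s j. v s j \<in> carrier F"
      and "\<And>s j. s \<in> fst ` set w \<Longrightarrow> s \<noteq> Gen_a 1 \<Longrightarrow> h (v s j) = f (s, j)" for v i w
    using that(1,3)
  proof (induction w arbitrary: i rule: height.induct)
    case 1
    show ?case by (simp add: cls_Nil pow_closed)
  next
    case (2 s e w)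
    then have sw: "s \<in> S" "w \<in> lists (S \<times> UNIV)" "[(s, e)] \<in> lists (S \<times> UNIV)" by simp_all
    have IH: "h (conjugate_rewrite F v i w) \<otimes>\<^bsub>L\<^esub> a [^]\<^bsub>L\<^esub> (i + height w) = a [^]\<^bsub>L\<^esub> i \<otimes>\<^bsub>L\<^esub> cls w" for i
      by (rule "2.IH"[OF sw(2)]) (use 2 in simp)
    have cons: "cls ((s, e) # w) = (if e then cls [(s, True)] else inv\<^bsub>L\<^esub> cls [(s, True)]) \<otimes>\<^bsub>L\<^esub> cls w"
      using cls_append[OF sw(3,2)] cls_inverse[OF sw(1)] by simp
    note c = cls_letter[OF sw(1)] cls_closed[OF sw(2)] pow_closed
      F.conjugate_rewrite_closed[of v, OF v]
    show ?case
    proof (cases "s = Gen_a 1")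
      case True
      have "a [^]\<^bsub>L\<^esub> (i + 1) = a [^]\<^bsub>L\<^esub> i \<otimes>\<^bsub>L\<^esub> a" "a [^]\<^bsub>L\<^esub> (i - 1) = a [^]\<^bsub>L\<^esub> i \<otimes>\<^bsub>L\<^esub> inv\<^bsub>L\<^esub> a"
        using a_closed by (simp_all add: L.int_pow_mult L.int_pow_diff)
      moreover have "cls ((s, e) # w) = (if e then a else inv\<^bsub>L\<^esub> a) \<otimes>\<^bsub>L\<^esub> cls w"
        using cons by (simp add: True a_def)
      ultimately show ?thesis
        using IH[of "i + 1"] IH[of "i - 1"] c a_closed True
        by (cases e) (simp_all add: L.m_assoc algebra_simps)
    next
      case False
      then have h_v: "h (v s i) = a [^]\<^bsub>L\<^esub> i \<otimes>\<^bsub>L\<^esub> cls [(s, True)] \<otimes>\<^bsub>L\<^esub> inv\<^bsub>L\<^esub> (a [^]\<^bsub>L\<^esub> i)"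
        using 2(3)[of s i] sw(1) by (simp add: f_def)
      let ?c = "if e then cls [(s, True)] else inv\<^bsub>L\<^esub> cls [(s, True)]"
      have "h (if e then v s i else inv\<^bsub>F\<^esub> v s i) = a [^]\<^bsub>L\<^esub> i \<otimes>\<^bsub>L\<^esub> ?c \<otimes>\<^bsub>L\<^esub> inv\<^bsub>L\<^esub> (a [^]\<^bsub>L\<^esub> i)"
        using v c by (simp add: h_v inv_conj)
      moreover have "h (conjugate_rewrite F v i ((s, e) # w))
          = h (if e then v s i else inv\<^bsub>F\<^esub> v s i) \<otimes>\<^bsub>L\<^esub> h (conjugate_rewrite F v i w)"
        using False v c by simp
      ultimately have "h (conjugate_rewrite F v i ((s, e) # w)) \<otimes>\<^bsub>L\<^esub> a [^]\<^bsub>L\<^esub> (i + height w)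
          = (a [^]\<^bsub>L\<^esub> i \<otimes>\<^bsub>L\<^esub> ?c \<otimes>\<^bsub>L\<^esub> inv\<^bsub>L\<^esub> (a [^]\<^bsub>L\<^esub> i)) \<otimes>\<^bsub>L\<^esub>
            (h (conjugate_rewrite F v i w) \<otimes>\<^bsub>L\<^esub> a [^]\<^bsub>L\<^esub> (i + height w))"
        using c by (simp add: L.m_assoc)
      also have "\<dots> = a [^]\<^bsub>L\<^esub> i \<otimes>\<^bsub>L\<^esub> (?c \<otimes>\<^bsub>L\<^esub> cls w)"
        unfolding IH by (rule conj) (use c in auto)
      finally show ?thesis using False by (simp add: cons)
    qed
  qed

  have b: "cls [(Gen_b 1, True)] \<in> carrier L" (is "?b \<in> _") using ab_S by (intro cls_letter)
  \<comment> \<open>The relator solved for r, in a form without inverses.\<close>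
  have R: "cls r \<otimes>\<^bsub>L\<^esub> (a \<otimes>\<^bsub>L\<^esub> ?b) = ?b \<otimes>\<^bsub>L\<^esub> a"
  proof -
    have relator_lists: "surface_relator g \<in> lists (S \<times> UNIV)"
      unfolding relator using ab_S r_lists by auto
    have "cls (surface_relator g) = \<one>\<^bsub>L\<^esub>"
      unfolding cls_def L_eq by (rule group_word_relator[OF _ relator_lists]) simp
    moreover have cons: "cls ((s, e) # w) = cls [(s, e)] \<otimes>\<^bsub>L\<^esub> cls w"
      if "s \<in> S" "w \<in> lists (S \<times> UNIV)" for s e w
      using cls_append[of "[(s, e)]" w] that by simp
    have "cls (surface_relator g) = a \<otimes>\<^bsub>L\<^esub> (?b \<otimes>\<^bsub>L\<^esub> (inv\<^bsub>L\<^esub> a \<otimes>\<^bsub>L\<^esub> (inv\<^bsub>L\<^esub> ?b \<otimes>\<^bsub>L\<^esub> cls r)))"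
      using ab_S r_lists
        cons[OF ab_S(2) r_lists, of False]
        cons[of "Gen_a 1" "(Gen_b 1, False) # r" False]
        cons[of "Gen_b 1" "(Gen_a 1, False) # (Gen_b 1, False) # r" True]
        cons[of "Gen_a 1" "(Gen_b 1, True) # (Gen_a 1, False) # (Gen_b 1, False) # r" True]
      by (simp add: relator cls_inverse a_def del: in_lists_conv_set)
    ultimately have "(a \<otimes>\<^bsub>L\<^esub> ?b \<otimes>\<^bsub>L\<^esub> inv\<^bsub>L\<^esub> a \<otimes>\<^bsub>L\<^esub> inv\<^bsub>L\<^esub> ?b) \<otimes>\<^bsub>L\<^esub> cls r = \<one>\<^bsub>L\<^esub>"
      using a_closed b cls_closed[OF r_lists] by (simp add: L.m_assoc)
    then have "inv\<^bsub>L\<^esub> cls r = a \<otimes>\<^bsub>L\<^esub> ?b \<otimes>\<^bsub>L\<^esub> inv\<^bsub>L\<^esub> a \<otimes>\<^bsub>L\<^esub> inv\<^bsub>L\<^esub> ?b"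
      using a_closed b cls_closed[OF r_lists] by (intro L.inv_equality) auto
    then have "cls r = inv\<^bsub>L\<^esub> (a \<otimes>\<^bsub>L\<^esub> ?b \<otimes>\<^bsub>L\<^esub> inv\<^bsub>L\<^esub> a \<otimes>\<^bsub>L\<^esub> inv\<^bsub>L\<^esub> ?b)"
      using cls_closed[OF r_lists] by (metis L.inv_inv)
    moreover have "inv\<^bsub>L\<^esub> y \<otimes>\<^bsub>L\<^esub> (y \<otimes>\<^bsub>L\<^esub> z) = z" if "y \<in> carrier L" "z \<in> carrier L" for y z
      using that by (simp flip: L.m_assoc)
    ultimately show ?thesis
      using a_closed b by (simp add: L.inv_mult_group L.m_assoc)
  qed
  have h_\<omega>: "h (\<omega> j) \<otimes>\<^bsub>L\<^esub> a [^]\<^bsub>L\<^esub> j = a [^]\<^bsub>L\<^esub> j \<otimes>\<^bsub>L\<^esub> cls r" for j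
    using key[OF r_lists, of gen j] by (simp add: gen_closed h_gen height_r \<omega>_def)
  \<comment> \<open>The actual conjugates of \<open>Gen_b 1\<close> obey the recursion that defines
    \<beta>. Together with agreement at 0 this shows that h sends \<beta>(j) to the j-th conjugate
    for every integer j.\<close>
  have f_step: "f (Gen_b 1, j) = h (\<omega> j) \<otimes>\<^bsub>L\<^esub> f (Gen_b 1, j + 1)" for j
  proof -
    note c = a_closed b cls_closed[OF r_lists] pow_closed[of j] h.hom_closed[OF \<omega>_closed[of j]]
    have "h (\<omega> j) \<otimes>\<^bsub>L\<^esub> f (Gen_b 1, j + 1)
        = (h (\<omega> j) \<otimes>\<^bsub>L\<^esub> a [^]\<^bsub>L\<^esub> j) \<otimes>\<^bsub>L\<^esub> (a \<otimes>\<^bsub>L\<^esub> ?b) \<otimes>\<^bsub>L\<^esub> inv\<^bsub>L\<^esub> a \<otimes>\<^bsub>L\<^esub> inv\<^bsub>L\<^esub> (a [^]\<^bsub>L\<^esub> j)"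
      using c ab_S by (simp add: f_def L.int_pow_mult L.inv_mult_group L.m_assoc)
    also have "\<dots> = a [^]\<^bsub>L\<^esub> j \<otimes>\<^bsub>L\<^esub> (cls r \<otimes>\<^bsub>L\<^esub> (a \<otimes>\<^bsub>L\<^esub> ?b)) \<otimes>\<^bsub>L\<^esub> inv\<^bsub>L\<^esub> a \<otimes>\<^bsub>L\<^esub> inv\<^bsub>L\<^esub> (a [^]\<^bsub>L\<^esub> j)"
      unfolding h_\<omega> using c by (simp add: L.m_assoc)
    also have "\<dots> = a [^]\<^bsub>L\<^esub> j \<otimes>\<^bsub>L\<^esub> ?b \<otimes>\<^bsub>L\<^esub> (a \<otimes>\<^bsub>L\<^esub> inv\<^bsub>L\<^esub> a) \<otimes>\<^bsub>L\<^esub> inv\<^bsub>L\<^esub> (a [^]\<^bsub>L\<^esub> j)"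
      unfolding R using c by (simp add: L.m_assoc del: L.r_inv)
    also have "\<dots> = f (Gen_b 1, j)" using c ab_S by (simp add: f_def)
    finally show ?thesis ..
  qed
  have h_\<beta>_iff: "h (\<beta> j) = f (Gen_b 1, j) \<longleftrightarrow> h (\<beta> (j + 1)) = f (Gen_b 1, j + 1)" for j
    unfolding f_step[of j] \<beta>_step[of j]
    by (simp add: \<omega>_closed \<beta>_closed f_closed)
  have h_\<beta>: "h (\<beta> j) = f (Gen_b 1, j)" for j
  proof (induction j rule: int_induct[of _ 0])
    case (step1 j)
    then show ?case using h_\<beta>_iff[of j] by simp
  next
    case (step2 j)
    then show ?case using h_\<beta>_iff[of "j - 1"] by simp
  qed (simp add: \<beta>_0 h_gen)
  have key_val: "h (conjugate_rewrite F val 0 w) \<otimes>\<^bsub>L\<^esub> a [^]\<^bsub>L\<^esub> height w = cls w"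
    if "w \<in> lists (S \<times> UNIV)" for w
    using key[OF that, of val 0] val_closed that cls_closed[OF that] by (simp add: val_def h_\<beta> h_gen)

  obtain w where w: "w \<in> lists (S \<times> UNIV)" "x = cls w"
    using x unfolding cls_def L_def[symmetric] L_eq by (rule group_word_carrierE)
  define W where "W = concat (replicate n w)"
  have "cls W = x [^]\<^bsub>L\<^esub> n"
    unfolding w(2) cls_def L_eq group_word_def presented_group_eq W_def
    by (rule presented_monoid_pow[OF w(1), symmetric])
  also have "\<dots> = cls []" using n(2) by (simp add: L_def[symmetric] cls_Nil)
  finally have "(W, []) \<in> word_cong (S \<times> UNIV) (group_relations S {surface_relator g})"
    unfolding cls_def group_word_def using eq_equiv_class[OF _ equiv_word_cong] lists.Nil by metis
  from invariant[OF this] have W: "height W = 0" "conjugate_rewrite F val 0 W = \<one>\<^bsub>F\<^esub>"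
    by simp_all
  have "height w = 0" using W(1) n(1) by (simp add: W_def height_concat_replicate)
  moreover from this have "conjugate_rewrite F val 0 w [^]\<^bsub>F\<^esub> n = \<one>\<^bsub>F\<^esub>"
    using W(2) F.conjugate_rewrite_concat_replicate[of val, OF val_closed] by (simp add: W_def)
  then have "conjugate_rewrite F val 0 w = \<one>\<^bsub>F\<^esub>"
    using closed n(1) free_group_torsion_free unfolding F_def by blast
  ultimately have "cls w = \<one>\<^bsub>L\<^esub>" using key_val[OF w(1)] by simp
  then show ?thesis using w(2) by (simp add: L_def)
qed

section \<open>Torsion in free products\<close>

definition free_product_relations :: "'i set \<Rightarrow> ('i \<Rightarrow> 'a monoid) \<Rightarrow> (('i \<times> 'a) list \<times> ('i \<times> 'a) list) set" where
  "free_product_relations I G =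
     {([(i, x), (i, y)], [(i, x \<otimes>\<^bsub>G i\<^esub> y)]) | i x y.
        i \<in> I \<and> x \<in> carrier (G i) \<and> y \<in> carrier (G i)}
     \<union> {([(i, \<one>\<^bsub>G i\<^esub>)], []) | i. i \<in> I}"

lemma free_product_eq:
  "free_product I G = presented_monoid (SIGMA i:I. carrier (G i)) (free_product_relations I G)"
  by (simp add: free_product_def free_product_relations_def)

definition letter_class :: "'i set \<Rightarrow> ('i \<Rightarrow> 'a monoid) \<Rightarrow> 'i \<Rightarrow> 'a \<Rightarrow> ('i \<times> 'a) list set" where
  "letter_class I G i x =
     word_cong (SIGMA i:I. carrier (G i)) (free_product_relations I G) `` {[(i, x)]}"

text \<open>Identity letters are included so that clash-free words of length at least 2 are reduced.
  Every letter clashes with itself, and therefore a torsion element may end up conjugate to an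
  arbitrary single letter.\<close>

definition product_clash :: "('i \<Rightarrow> 'a monoid) \<Rightarrow> 'i \<times> 'a \<Rightarrow> 'i \<times> 'a \<Rightarrow> bool" where
  "product_clash G a b \<longleftrightarrow>
     fst a = fst b \<or> snd a = \<one>\<^bsub>G (fst a)\<^esub> \<or> snd b = \<one>\<^bsub>G (fst b)\<^esub>"

definition cons_nontrivial :: "('i \<Rightarrow> 'a monoid) \<Rightarrow> 'i \<Rightarrow> 'a \<Rightarrow> ('i \<times> 'a) list \<Rightarrow> ('i \<times> 'a) list" where
  "cons_nontrivial G i x w = (if x = \<one>\<^bsub>G i\<^esub> then w else (i, x) # w)"

fun letter_act :: "('i \<Rightarrow> 'a monoid) \<Rightarrow> 'i \<times> 'a \<Rightarrow> ('i \<times> 'a) list \<Rightarrow> ('i \<times> 'a) list" where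
  "letter_act G (i, x) [] = cons_nontrivial G i x []"
| "letter_act G (i, x) ((j, y) # w) =
     (if j = i then cons_nontrivial G i (x \<otimes>\<^bsub>G i\<^esub> y) w else cons_nontrivial G i x ((j, y) # w))"

locale free_product_groups =
  fixes I :: "'i set" and G :: "'i \<Rightarrow> 'a monoid"
  assumes groups: "i \<in> I \<Longrightarrow> group (G i)"
begin

abbreviation (input) "A \<equiv> SIGMA i:I. carrier (G i)"
abbreviation (input) "R \<equiv> free_product_relations I G"

definition reduced :: "('i \<times> 'a) list set" where
  "reduced = {w \<in> lists A. (\<forall>(i, x)\<in>set w. x \<noteq> \<one>\<^bsub>G i\<^esub>) \<and> successively (\<lambda>a b. fst a \<noteq> fst b) w}"

lemma cons_nontrivial_reduced:
  assumes "i \<in> I" "x \<in> carrier (G i)" "w \<in> reduced" "w = [] \<or> fst (hd w) \<noteq> i"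
  shows "cons_nontrivial G i x w \<in> reduced"
  using assms by (cases w) (auto simp: reduced_def cons_nontrivial_def)

text \<open>Allowing y to be the identity gives all reduced words one common shape relative to the
  factor i. In these coordinates a letter of that factor acts by multiplying y, and the relations
  become the group laws of \<open>G i\<close>.\<close>

lemma reduced_decompose:
  assumes "w \<in> reduced" "i \<in> I"
  obtains y v where "y \<in> carrier (G i)" "v \<in> reduced" "v = [] \<or> fst (hd v) \<noteq> i"
    "w = cons_nontrivial G i y v"
proof (cases "w \<noteq> [] \<and> fst (hd w) = i")
  case True
  then obtain y v where w: "w = (i, y) # v" by (cases w) auto
  show thesis
    by (rule that[of y v]) (use assms w in \<open>auto simp: reduced_def cons_nontrivial_def successively_Cons\<close>)
next
  case False
  interpret group "G i" using groups assms(2) .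
  show thesis
    by (rule that[of "\<one>\<^bsub>G i\<^esub>" w]) (use assms False in \<open>auto simp: cons_nontrivial_def\<close>)
qed

lemma letter_act_cons_nontrivial:
  assumes "i \<in> I" "x \<in> carrier (G i)" "y \<in> carrier (G i)" "v = [] \<or> fst (hd v) \<noteq> i"
  shows "letter_act G (i, x) (cons_nontrivial G i y v) = cons_nontrivial G i (x \<otimes>\<^bsub>G i\<^esub> y) v"
proof -
  interpret group "G i" using groups assms(1) .
  show ?thesis using assms(2-) by (cases v) (auto simp: cons_nontrivial_def)
qed

lemma letter_act_reduced:
  assumes "a \<in> A" "w \<in> reduced"
  shows "letter_act G a w \<in> reduced"
proof -
  obtain i x where a: "a = (i, x)" "i \<in> I" "x \<in> carrier (G i)" using assms(1) by auto
  interpret group "G i" using groups a(2) .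
  show ?thesis
    using assms(2) a by (elim reduced_decompose[of w i])
      (auto simp: letter_act_cons_nontrivial intro!: cons_nontrivial_reduced)
qed

lemma word_cong_letter_act:
  assumes "(u, v) \<in> word_cong A R"
  shows "foldr (letter_act G) u [] = foldr (letter_act G) v []"
  using assms
proof (rule word_cong_foldr[where W = reduced])
  fix l r w assume lr: "(l, r) \<in> R" and w: "w \<in> reduced"
  from lr show "foldr (letter_act G) l w = foldr (letter_act G) r w"
    unfolding free_product_relations_def
  proof (elim UnE CollectE exE conjE)
    fix i x y assume eq: "(l, r) = ([(i, x), (i, y)], [(i, x \<otimes>\<^bsub>G i\<^esub> y)])"
      and i: "i \<in> I" and xy: "x \<in> carrier (G i)" "y \<in> carrier (G i)"
    interpret group "G i" using groups i .
    obtain z v where z: "z \<in> carrier (G i)" "v = [] \<or> fst (hd v) \<noteq> i" "w = cons_nontrivial G i z v"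
      using w i by (rule reduced_decompose)
    have lr: "l = [(i, x), (i, y)]" "r = [(i, x \<otimes>\<^bsub>G i\<^esub> y)]" using eq by simp_all
    show ?thesis
      unfolding lr z(3) using i xy z(1,2) by (simp add: letter_act_cons_nontrivial m_assoc)
  next
    fix i assume eq: "(l, r) = ([(i, \<one>\<^bsub>G i\<^esub>)], [])" and i: "i \<in> I"
    interpret group "G i" using groups i .
    obtain z v where z: "z \<in> carrier (G i)" "v = [] \<or> fst (hd v) \<noteq> i" "w = cons_nontrivial G i z v"
      using w i by (rule reduced_decompose)
    have lr: "l = [(i, \<one>\<^bsub>G i\<^esub>)]" "r = []" using eq by simp_all
    show ?thesis
      unfolding lr z(3) using i z(1,2) by (simp add: letter_act_cons_nontrivial)
  qed
next
  show "[] \<in> reduced" by (simp add: reduced_def)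
qed (rule letter_act_reduced)

lemma foldr_letter_act_reduced:
  "w \<in> reduced \<Longrightarrow> foldr (letter_act G) w [] = w"
proof (induction w)
  case (Cons a w)
  then have "w \<in> reduced" by (auto simp: reduced_def successively_Cons)
  with Cons show ?case
    by (cases a; cases w) (auto simp: reduced_def cons_nontrivial_def)
qed simp

text \<open>Length at least 2 matters: a lone identity letter has no neighbour with which to
  clash.\<close>

lemma clash_free_reduced:
  assumes "w \<in> lists A" "length w \<ge> 2" "successively (\<lambda>a b. \<not> product_clash G a b) w"
  shows "w \<in> reduced"
proof -
  have "(\<forall>(i, x)\<in>set (a # b # w). x \<noteq> \<one>\<^bsub>G i\<^esub>) \<and> successively (\<lambda>a b. fst a \<noteq> fst b) (a # b # w)"
    if "successively (\<lambda>a b. \<not> product_clash G a b) (a # b # w)" for a b w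
    using that
  proof (induction w arbitrary: a b)
    case (Cons c w)
    then show ?case using Cons.IH[of b c] by (auto simp: product_clash_def)
  qed (auto simp: product_clash_def)
  then show ?thesis using assms
    by (cases w rule: remdups_adj.cases) (auto simp: reduced_def)
qed

sublocale product: reduced_word_presentation A R "product_clash G"
proof (rule reduced_word_presentation.intro)
  show "group (presented_monoid A R)"
    using group_free_product[of I G] groups unfolding free_product_eq by blast
next
  fix a b assume ab: "a \<in> A" "b \<in> A" "product_clash G a b"
  obtain i x j y where eq: "a = (i, x)" "b = (j, y)" by (cases a; cases b)
  have mem: "i \<in> I" "x \<in> carrier (G i)" "j \<in> I" "y \<in> carrier (G j)" using ab eq by auto
  interpret group "G i" using groups mem(1) .
  have ctx: "(u @ l @ v, u @ r @ v) \<in> word_cong A R"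
    if "(l, r) \<in> R" "l \<in> lists A" "r \<in> lists A" "u \<in> lists A" "v \<in> lists A" for l r u v
    using that by (rule word_cong.rel)
  consider "i = j" | "x = \<one>\<^bsub>G i\<^esub>" | "y = \<one>\<^bsub>G j\<^esub>"
    using ab(3) by (auto simp: product_clash_def eq)
  then show "\<exists>w\<in>lists A. ([a, b], w) \<in> word_cong A R \<and> length w < 2"
  proof cases
    case 1
    then have y: "y \<in> carrier (G i)" using mem(4) by simp
    then have xy: "x \<otimes>\<^bsub>G i\<^esub> y \<in> carrier (G i)" by (rule m_closed[OF mem(2)])
    have "([a, b], [(i, x \<otimes>\<^bsub>G i\<^esub> y)]) \<in> R"
      using mem(1,2) y 1 unfolding free_product_relations_def eq by blast
    from ctx[OF this, of "[]" "[]"] show ?thesis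
      using ab(1,2) xy mem(1) by (intro bexI[of _ "[(i, x \<otimes>\<^bsub>G i\<^esub> y)]"]) simp_all
  next
    case 2
    then have "([a], []) \<in> R" using mem(1) unfolding free_product_relations_def eq by blast
    from ctx[OF this, of "[]" "[b]"] show ?thesis
      using ab(1,2) by (intro bexI[of _ "[b]"]) simp_all
  next
    case 3
    then have "([b], []) \<in> R" using mem(3) unfolding free_product_relations_def eq by blast
    from ctx[OF this, of "[a]" "[]"] show ?thesis
      using ab(1,2) by (intro bexI[of _ "[a]"]) simp_all
  qed
next
  fix w assume w: "w \<in> lists A" "length w \<ge> 2" "successively (\<lambda>a b. \<not> product_clash G a b) w"
  then have "foldr (letter_act G) w [] = w"
    by (intro foldr_letter_act_reduced clash_free_reduced)
  moreover have "w \<noteq> []" using w(2) by auto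
  ultimately show "(w, []) \<notin> word_cong A R" using word_cong_letter_act[of w "[]"] by auto
qed

lemma letter_class_hom:
  assumes "i \<in> I"
  shows "letter_class I G i \<in> hom (G i) (free_product I G)"
proof (rule homI)
  fix x assume x: "x \<in> carrier (G i)"
  then show "letter_class I G i x \<in> carrier (free_product I G)"
    using assms unfolding letter_class_def free_product_eq
    by (intro presented_monoid_class_in_carrier) simp
  fix y assume y: "y \<in> carrier (G i)"
  interpret group "G i" using groups assms .
  have "([] @ [(i, x), (i, y)] @ [], [] @ [(i, x \<otimes>\<^bsub>G i\<^esub> y)] @ []) \<in> word_cong A R"
    by (rule word_cong.rel) (use x y assms in \<open>auto simp: free_product_relations_def\<close>)
  then show "letter_class I G i (x \<otimes>\<^bsub>G i\<^esub> y)
      = letter_class I G i x \<otimes>\<^bsub>free_product I G\<^esub> letter_class I G i y"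
    using presented_monoid_class_eq presented_monoid_mult[of "[(i, x)]" A "[(i, y)]" R] x y assms
    by (fastforce simp: letter_class_def free_product_eq)
qed

text \<open>The factors embed: applied to the empty word, the letter gives the empty word only if x
  is the identity.\<close>

lemma letter_class_eq_one:
  assumes "i \<in> I" "x \<in> carrier (G i)" "letter_class I G i x = \<one>\<^bsub>free_product I G\<^esub>"
  shows "x = \<one>\<^bsub>G i\<^esub>"
proof -
  have "([(i, x)], []) \<in> word_cong A R"
    using assms(3) eq_equiv_class[OF _ equiv_word_cong] lists.Nil
    unfolding letter_class_def free_product_eq presented_monoid_one by metis
  from word_cong_letter_act[OF this] show ?thesis
    by (auto simp: cons_nontrivial_def split: if_splits)
qed

lemma letter_class_pow_eq_one_iff:
  assumes "i \<in> I" "x \<in> carrier (G i)"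
  shows "letter_class I G i x [^]\<^bsub>free_product I G\<^esub> (n::nat) = \<one>\<^bsub>free_product I G\<^esub>
    \<longleftrightarrow> x [^]\<^bsub>G i\<^esub> n = \<one>\<^bsub>G i\<^esub>"
proof -
  interpret Gi: group "G i" using groups assms(1) .
  interpret P: group "free_product I G" using groups by (rule group_free_product)
  interpret group_hom "G i" "free_product I G" "letter_class I G i"
    by (rule group_hom.intro[OF Gi.group_axioms P.group_axioms
          group_hom_axioms.intro[OF letter_class_hom[OF assms(1)]]])
  have "letter_class I G i x [^]\<^bsub>free_product I G\<^esub> n = letter_class I G i (x [^]\<^bsub>G i\<^esub> n)"
    using assms(2) by (simp add: hom_nat_pow)
  then show ?thesis
    using letter_class_eq_one[OF assms(1), of "x [^]\<^bsub>G i\<^esub> n"] assms(2) hom_one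
    by (metis Gi.nat_pow_closed)
qed

theorem torsion_conjugate_into_factor:
  assumes \<gamma>: "\<gamma> \<in> carrier (free_product I G)" "\<gamma> \<noteq> \<one>\<^bsub>free_product I G\<^esub>"
    and n: "n > 0" "\<gamma> [^]\<^bsub>free_product I G\<^esub> (n::nat) = \<one>\<^bsub>free_product I G\<^esub>"
  obtains g i x where "g \<in> carrier (free_product I G)" "i \<in> I" "x \<in> carrier (G i)"
    "\<gamma> \<otimes>\<^bsub>free_product I G\<^esub> g = g \<otimes>\<^bsub>free_product I G\<^esub> letter_class I G i x"
proof -
  interpret P: group "free_product I G" using groups by (rule group_free_product)
  obtain g w where g: "g \<in> carrier (free_product I G)" and w: "w \<in> lists A"
    and eq: "\<gamma> \<otimes>\<^bsub>free_product I G\<^esub> g = g \<otimes>\<^bsub>free_product I G\<^esub> word_cong A R `` {w}"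
    and short: "w = [] \<or> (\<exists>a. w = [a] \<and> product_clash G a a)"
    using product.torsion_conjugate_to_letter \<gamma>(1) n unfolding free_product_eq by metis
  have "w \<noteq> []"
  proof
    assume "w = []"
    then have "\<gamma> \<otimes>\<^bsub>free_product I G\<^esub> g = g"
      using eq g P.r_one by (simp add: free_product_eq flip: presented_monoid_one)
    then show False using \<gamma> g by (simp add: P.l_cancel_one')
  qed
  then obtain i x where "w = [(i, x)]" using short by auto
  then show thesis using that[of g i x] g w eq by (simp add: letter_class_def)
qed

end

section \<open>Random representations of free products\<close>

lemma word_eval_cong:
  "(\<And>a. a \<in> set w \<Longrightarrow> f a = f' a) \<Longrightarrow> word_eval M f w = word_eval M f' w"
  by (induction w) simp_all

text \<open>A homomorphism is determined by its values on the finitely many signed generators.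
  Finiteness gives the uniform distribution its meaning for infinite groups, and the passage to an
  image K lets it be carried along an isomorphism.\<close>

lemma finite_perm_reps_presented_image:
  assumes K: "group K" and S: "finite S"
    and k: "k \<in> hom (presented_group S R) K" "k ` carrier (presented_group S R) = carrier K"
  shows "finite (perm_reps K N)"
proof (rule inj_on_finite)
  let ?f = "\<lambda>\<phi>. \<lambda>a\<in>S \<times> (UNIV :: bool set). \<phi> (k (group_word S R [a]))"
  let ?P = "presented_group S R"
  have k_closed: "k y \<in> carrier K" if "y \<in> carrier ?P" for y using that k by (auto simp: hom_def)
  show "inj_on ?f (perm_reps K N)"
  proof (rule inj_onI, rule ext)
    fix \<phi> \<psi> y assume \<phi>: "\<phi> \<in> perm_reps K N" and \<psi>: "\<psi> \<in> perm_reps K N" and eq: "?f \<phi> = ?f \<psi>"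
    show "\<phi> y = \<psi> y"
    proof (cases "y \<in> carrier K")
      case True
      then obtain z where z: "z \<in> carrier ?P" "y = k z" using k(2) by blast
      obtain w where w: "w \<in> lists (S \<times> UNIV)" "z = group_word S R w"
        using z(1) by (rule group_word_carrierE)
      have eval: "\<theta> y = word_eval (sym_group N) (\<lambda>a. (\<theta> \<circ> k) (group_word S R [a])) w"
        if "\<theta> \<in> perm_reps K N" for \<theta>
      proof -
        have "\<theta> \<circ> k \<in> hom ?P (sym_group N)" using that k(1) by (auto simp: perm_reps_def intro: hom_compose)
        from hom_class_eq_word_eval[OF group_presented_group[unfolded presented_group_eq]
            sym_group_is_group this[unfolded presented_group_eq] w(1)]
        have "(\<theta> \<circ> k) (group_word S R w)
            = word_eval (sym_group N) (\<lambda>a. (\<theta> \<circ> k) (group_word S R [a])) w"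
          unfolding group_word_def .
        then show ?thesis by (simp add: z(2) w(2))
      qed
      have "(\<phi> \<circ> k) (group_word S R [a]) = (\<psi> \<circ> k) (group_word S R [a])" if "a \<in> set w" for a
        using fun_cong[OF eq, of a] w(1) that by auto
      then show ?thesis unfolding eval[OF \<phi>] eval[OF \<psi>] by (rule word_eval_cong)
    qed (use \<phi> \<psi> in \<open>auto simp: perm_reps_def extensional_def\<close>)
  qed
  show "?f ` perm_reps K N \<subseteq> (S \<times> (UNIV :: bool set)) \<rightarrow>\<^sub>E {p. p permutes {1..N}}"
  proof (rule image_subsetI, rule PiE_I)
    fix \<phi> a assume \<phi>: "\<phi> \<in> perm_reps K N" and a: "a \<in> S \<times> (UNIV :: bool set)"
    have "k (group_word S R [a]) \<in> carrier K" using a by (intro k_closed group_word_closed) simp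
    then show "?f \<phi> a \<in> {p. p permutes {1..N}}"
      using \<phi> a by (auto simp: perm_reps_def hom_def Pi_iff sym_group_carrier)
  qed simp
  show "finite ((S \<times> (UNIV :: bool set)) \<rightarrow>\<^sub>E {p. p permutes {1..N}})"
    using S by (intro finite_PiE) (auto simp: finite_permutations)
qed

lemma finite_perm_reps_iso_presented:
  assumes "group K" "finite S" "K \<cong> presented_group S R"
  shows "finite (perm_reps K N)"
proof -
  obtain f where "f \<in> iso K (presented_group S R)" using assms(3) by (auto simp: is_iso_def)
  then have "inv_into (carrier K) f \<in> iso (presented_group S R) K" by (rule group.iso_set_sym[OF assms(1)])
  then show ?thesis
    using finite_perm_reps_presented_image[OF assms(1,2)] by (auto simp: iso_def bij_betw_def)
qed

lemma admissible_factor_finite_perm_reps: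
  assumes "admissible_factor K"
  shows "finite (perm_reps K N)"
proof -
  have K: "group K" using assms by (simp add: admissible_factor_def)
  consider "finite (carrier K)" | n :: nat where "K \<cong> free_group {1..n}" | g where "K \<cong> surface_group g"
    using assms by (auto simp: admissible_factor_def)
  then show ?thesis
  proof cases
    case 1
    then show ?thesis by (simp add: perm_reps_eq_actions finite_actions)
  next
    case 2
    then show ?thesis
      unfolding free_group_def by (rule finite_perm_reps_iso_presented[OF K finite_atLeastAtMost])
  next
    case 3
    have "finite (Gen_a ` {1..g} \<union> Gen_b ` {1..g})" by simp
    from finite_perm_reps_iso_presented[OF K this] 3 show ?thesis
      unfolding surface_group_def by blast
  qed
qed

lemma torsion_free_iso:
  assumes "group K" "group P" "K \<cong> P"
    and P: "\<And>y. y \<in> carrier P \<Longrightarrow> y [^]\<^bsub>P\<^esub> n = \<one>\<^bsub>P\<^esub> \<Longrightarrow> y = \<one>\<^bsub>P\<^esub>"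
    and x: "x \<in> carrier K" "x [^]\<^bsub>K\<^esub> (n::nat) = \<one>\<^bsub>K\<^esub>"
  shows "x = \<one>\<^bsub>K\<^esub>"
proof -
  obtain f where f: "f \<in> hom K P" "bij_betw f (carrier K) (carrier P)"
    using assms(3) by (auto simp: is_iso_def iso_def)
  interpret group_hom K P f
    by (rule group_hom.intro[OF assms(1,2) group_hom_axioms.intro[OF f(1)]])
  have "f x [^]\<^bsub>P\<^esub> n = \<one>\<^bsub>P\<^esub>" using x hom_nat_pow[of x n] hom_one by simp
  then have "f x = \<one>\<^bsub>P\<^esub>" by (rule P[OF hom_closed[OF x(1)]])
  then have "f x = f \<one>\<^bsub>K\<^esub>" by (simp only: hom_one)
  then show ?thesis by (rule inj_onD[OF bij_betw_imp_inj_on[OF f(2)]]) (use x(1) in simp_all)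
qed

lemma admissible_factor_finite_or_torsion_free:
  assumes K: "admissible_factor K" and n: "n > 0"
    and x: "x \<in> carrier K" "x [^]\<^bsub>K\<^esub> (n::nat) = \<one>\<^bsub>K\<^esub>" "x \<noteq> \<one>\<^bsub>K\<^esub>"
  shows "finite (carrier K)"
proof (rule ccontr)
  assume "infinite (carrier K)"
  then consider m :: nat where "K \<cong> free_group {1..m}" | g where "g \<ge> 2" "K \<cong> surface_group g"
    using K by (auto simp: admissible_factor_def)
  moreover have group: "group K" using K by (simp add: admissible_factor_def)
  ultimately show False
  proof cases
    case 1
    have "group (free_group {1..m})" unfolding free_group_def by (rule group_presented_group)
    from torsion_free_iso[OF group this 1 free_group_torsion_free[OF _ n] x(1,2)]
    have "x = \<one>\<^bsub>K\<^esub>" .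
    then show False using x(3) by simp
  next
    case 2
    have "group (surface_group g)" unfolding surface_group_def by (rule group_presented_group)
    moreover have "g \<ge> 1" using 2(1) by simp
    ultimately have "x = \<one>\<^bsub>K\<^esub>"
      using torsion_free_iso[OF group _ 2(2) surface_group_torsion_free[OF _ _ n] x(1,2)] by blast
    then show False using x(3) by simp
  qed
qed

section \<open>Restriction of a representation to the factors\<close>

context free_product_groups
begin

text \<open>The universal property of the free product: a homomorphism amounts to an independent
  choice of one homomorphism on each factor. Extensionality on both sides turns this into a
  bijection of sets of functions.\<close>

lemma bij_betw_perm_reps_free_product:
  "bij_betw (\<lambda>\<phi>. \<lambda>i\<in>I. \<lambda>x\<in>carrier (G i). \<phi> (letter_class I G i x))
     (perm_reps (free_product I G) N) (PiE I (\<lambda>i. perm_reps (G i) N))"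
  (is "bij_betw ?\<rho> ?A ?B")
proof -
  let ?P = "free_product I G" and ?S = "sym_group N"
  interpret P: group ?P using groups by (rule group_free_product)
  interpret S: group ?S by (rule sym_group_is_group)
  have "inj_on ?\<rho> ?A"
  proof (rule inj_onI, rule ext)
    fix \<phi> \<psi> X assume \<phi>: "\<phi> \<in> ?A" and \<psi>: "\<psi> \<in> ?A" and eq: "?\<rho> \<phi> = ?\<rho> \<psi>"
    show "\<phi> X = \<psi> X"
    proof (cases "X \<in> carrier ?P")
      case True
      then obtain w where w: "w \<in> lists A" "X = word_cong A R `` {w}"
        unfolding free_product_eq by (rule presented_monoid_carrierE)
      have eval: "\<theta> X = word_eval ?S (\<lambda>a. \<theta> (word_cong A R `` {[a]})) w" if "\<theta> \<in> ?A" for \<theta>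
        unfolding w(2)
        by (rule hom_class_eq_word_eval[where h = \<theta>, OF product.group S.group_axioms _ w(1)])
           (use that in \<open>simp add: perm_reps_def free_product_eq\<close>)
      have "\<phi> (word_cong A R `` {[a]}) = \<psi> (word_cong A R `` {[a]})" if "a \<in> set w" for a
      proof -
        obtain i x where a: "a = (i, x)" "i \<in> I" "x \<in> carrier (G i)" using w(1) \<open>a \<in> set w\<close> by auto
        show ?thesis
          using fun_cong[OF fun_cong[OF eq, of i], of x] a by (simp add: letter_class_def)
      qed
      then show ?thesis unfolding eval[OF \<phi>] eval[OF \<psi>] by (rule word_eval_cong)
    qed (use \<phi> \<psi> in \<open>auto simp: perm_reps_def extensional_def\<close>)
  qed
  moreover have "?\<rho> ` ?A \<subseteq> ?B"
  proof (rule image_subsetI, rule PiE_I)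
    fix \<phi> i assume \<phi>: "\<phi> \<in> ?A" and i: "i \<in> I"
    interpret Gi: group "G i" using groups i .
    have "\<phi> \<circ> letter_class I G i \<in> hom (G i) ?S"
      using \<phi> letter_class_hom[OF i] by (auto simp: perm_reps_def intro: hom_compose)
    then have "(\<lambda>x\<in>carrier (G i). \<phi> (letter_class I G i x)) \<in> hom (G i) ?S"
      by (rule Gi.hom_restrict) simp
    then show "?\<rho> \<phi> i \<in> perm_reps (G i) N" using i by (simp add: perm_reps_def)
  qed simp
  moreover have "?B \<subseteq> ?\<rho> ` ?A"
  proof
    fix \<theta> assume \<theta>: "\<theta> \<in> ?B"
    have \<theta>_hom: "\<theta> i \<in> hom (G i) ?S" and \<theta>_ext: "\<theta> i \<in> extensional (carrier (G i))" if "i \<in> I" for i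
      using \<theta> that by (auto simp: PiE_iff perm_reps_def)
    define f where "f = (\<lambda>(i, x). \<theta> i x)"
    have f: "f \<in> A \<rightarrow> carrier ?S"
      using \<theta>_hom by (auto simp: f_def hom_def Pi_iff)
    have R: "word_eval ?S f l = word_eval ?S f r"
      if "(l, r) \<in> R" "l \<in> lists A" "r \<in> lists A" for l r
      using that(1) unfolding free_product_relations_def
    proof (elim UnE CollectE exE conjE)
      fix i x y assume eq: "(l, r) = ([(i, x), (i, y)], [(i, x \<otimes>\<^bsub>G i\<^esub> y)])"
        and i: "i \<in> I" and xy: "x \<in> carrier (G i)" "y \<in> carrier (G i)"
      have "\<theta> i x \<in> carrier ?S" "\<theta> i y \<in> carrier ?S" using hom_in_carrier[OF \<theta>_hom[OF i]] xy by auto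
      then show ?thesis using eq hom_mult[OF \<theta>_hom[OF i] xy] by (simp add: f_def S.m_assoc)
    next
      fix i assume eq: "(l, r) = ([(i, \<one>\<^bsub>G i\<^esub>)], [])" and i: "i \<in> I"
      then show ?thesis using hom_one[OF \<theta>_hom[OF i] groups[OF i] S.group_axioms] by (simp add: f_def)
    qed
    define \<Phi> where "\<Phi> = restrict (presented_lift ?S f) (carrier ?P)"
    have "presented_lift ?S f \<in> hom ?P ?S"
      unfolding free_product_eq by (rule S.presented_lift_hom[OF f R])
    then have "\<Phi> \<in> hom ?P ?S" by (rule P.hom_restrict) (simp add: \<Phi>_def)
    then have \<Phi>: "\<Phi> \<in> ?A" by (simp add: perm_reps_def \<Phi>_def)
    have "?\<rho> \<Phi> = \<theta>"
    proof (rule ext, rule ext)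
      fix i x
      show "?\<rho> \<Phi> i x = \<theta> i x"
      proof (cases "i \<in> I \<and> x \<in> carrier (G i)")
        case True
        then have ix: "[(i, x)] \<in> lists A" by simp
        have "letter_class I G i x \<in> carrier ?P"
          using hom_in_carrier[OF letter_class_hom] True by blast
        then have "\<Phi> (letter_class I G i x) = word_eval ?S f [(i, x)]"
          unfolding \<Phi>_def letter_class_def by (simp add: S.presented_lift_class[OF f R ix])
        also have "\<dots> = \<theta> i x" using hom_in_carrier[OF \<theta>_hom] True by (simp add: f_def)
        finally show ?thesis using True by simp
      next
        case False
        then show ?thesis
          using \<theta> \<theta>_ext[of i] by (auto simp: PiE_iff extensional_def)
      qed
    qed
    then show "\<theta> \<in> ?\<rho> ` ?A" by (rule image_eqI[where x = \<Phi>, OF HOL.sym \<Phi>])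
  qed
  ultimately show ?thesis by (intro bij_betw_imageI subset_antisym)
qed

lemma finite_perm_reps_free_product:
  assumes "finite I" "\<And>i. i \<in> I \<Longrightarrow> finite (perm_reps (G i) N)"
  shows "finite (perm_reps (free_product I G) N)"
  unfolding bij_betw_finite[OF bij_betw_perm_reps_free_product] by (rule finite_PiE[OF assms])

text \<open>A coordinate of a uniformly random point of a finite product is uniform. The other
  factors contribute \<open>?rest\<close>, nonzero because trivial representations exist, to
  numerator and denominator alike.\<close>

lemma expected_fix_letter_class:
  assumes fin: "finite I" "\<And>i. i \<in> I \<Longrightarrow> finite (perm_reps (G i) N)"
    and i: "i \<in> I" and x: "x \<in> carrier (G i)"
  shows "expected_fix (free_product I G) (letter_class I G i x) N = expected_fix (G i) x N"
proof -
  let ?A = "perm_reps (free_product I G) N" and ?B = "\<lambda>j. perm_reps (G j) N"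
  let ?\<rho> = "\<lambda>\<phi>. \<lambda>i\<in>I. \<lambda>x\<in>carrier (G i). \<phi> (letter_class I G i x)"
  let ?rest = "\<Prod>j\<in>I - {i}. real (card (?B j))"
  have nonempty: "card (?B j) \<noteq> 0" if "j \<in> I" for j
    using fin(2)[OF that] group.actions_nonempty[OF groups[OF that]] by (simp add: perm_reps_eq_actions)
  have "(\<Sum>\<phi>\<in>?A. real (fix_count (letter_class I G i x) N \<phi>))
      = (\<Sum>\<phi>\<in>?A. real (fix_count x N (?\<rho> \<phi> i)))"
    using i x by (simp add: fix_count_def)
  also have "\<dots> = (\<Sum>\<theta>\<in>PiE I ?B. real (fix_count x N (\<theta> i)))"
    by (rule sum.reindex_bij_betw[OF bij_betw_perm_reps_free_product])
  \<comment> \<open>Written as a product over all coordinates, the summand allows sum and product to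
    be exchanged.\<close>
  also have "\<dots> = (\<Sum>\<theta>\<in>PiE I ?B. \<Prod>j\<in>I. if j = i then real (fix_count x N (\<theta> j)) else 1)"
    using fin(1) i by (simp add: prod.delta)
  also have "\<dots> = (\<Prod>j\<in>I. \<Sum>\<psi>\<in>?B j. if j = i then real (fix_count x N \<psi>) else 1)"
    by (rule prod_sum_PiE[symmetric]) (use fin in auto)
  also have "\<dots> = (\<Sum>\<psi>\<in>?B i. real (fix_count x N \<psi>)) * ?rest"
    using fin(1) i by (subst prod.remove[of _ i]) (auto intro!: prod.cong)
  finally have num: "(\<Sum>\<phi>\<in>?A. real (fix_count (letter_class I G i x) N \<phi>))
      = (\<Sum>\<psi>\<in>?B i. real (fix_count x N \<psi>)) * ?rest" .
  have "card ?A = card (PiE I ?B)"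
    by (rule bij_betw_same_card[OF bij_betw_perm_reps_free_product])
  then have "real (card ?A) = real (card (?B i)) * ?rest"
    using fin(1) i by (simp add: card_PiE prod.remove[of _ i])
  moreover have "?rest \<noteq> 0" using nonempty fin(1) by simp
  moreover have "group (free_product I G)" using groups by (rule group_free_product)
  ultimately show ?thesis
    using num fin i groups
    by (simp add: expected_fix_eq_sum finite_perm_reps_free_product)
qed

end

text \<open>The permutation assigned to g carries the fixed points of y onto those of x.\<close>

lemma fix_count_conjugate:
  assumes K: "group K" and \<phi>: "\<phi> \<in> perm_reps K N"
    and xyg: "x \<in> carrier K" "y \<in> carrier K" "g \<in> carrier K" "x \<otimes>\<^bsub>K\<^esub> g = g \<otimes>\<^bsub>K\<^esub> y"
  shows "fix_count x N \<phi> = fix_count y N \<phi>"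
proof -
  have \<phi>': "\<phi> \<in> actions K {1..N}" using \<phi> by (simp add: perm_reps_eq_actions)
  have g: "\<phi> g permutes {1..N}" using actionsD(1)[OF \<phi>' xyg(3)] .
  have comm: "\<phi> x (\<phi> g p) = \<phi> g (\<phi> y p)" for p
    using actionsD(3)[OF \<phi>'] xyg by (metis comp_apply)
  have "bij_betw (\<phi> g) {p \<in> {1..N}. \<phi> y p = p} {p \<in> {1..N}. \<phi> x p = p}"
  proof (rule bij_betw_imageI)
    show "inj_on (\<phi> g) {p \<in> {1..N}. \<phi> y p = p}" using permutes_inj[OF g] inj_on_subset by blast
    have "q \<in> \<phi> g ` {p \<in> {1..N}. \<phi> y p = p}" if q: "q \<in> {1..N}" "\<phi> x q = q" for q
    proof -
      obtain p where p: "q = \<phi> g p" using permutes_surj[OF g] by (metis surjD)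
      have "p \<in> {1..N}" using q(1) p permutes_in_image[OF g] by blast
      moreover have "\<phi> y p = p" using q(2) p comm permutes_inj[OF g] by (metis injD)
      ultimately show ?thesis using p by blast
    qed
    then show "\<phi> g ` {p \<in> {1..N}. \<phi> y p = p} = {p \<in> {1..N}. \<phi> x p = p}"
      using comm permutes_in_image[OF g] by auto
  qed
  then show ?thesis by (simp add: fix_count_def bij_betw_same_card)
qed

theorem proposition1p2:
  fixes k :: nat
    and G :: "nat \<Rightarrow> 'a monoid"
    and \<Gamma> :: "(nat \<times> 'a) list set monoid"
    and \<gamma> :: "(nat \<times> 'a) list set"
  assumes "k \<ge> 1"
    and "\<And>i. i \<in> {1..k} \<Longrightarrow> admissible_factor (G i)"
    and "\<Gamma> = free_product {1..k} G"
    and "\<gamma> \<in> carrier \<Gamma>"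
    and "\<exists>n::nat. n > 0 \<and> \<gamma> [^]\<^bsub>\<Gamma>\<^esub> n = \<one>\<^bsub>\<Gamma>\<^esub>"
  shows "(\<lambda>N::nat. expected_fix \<Gamma> \<gamma> N - real N powr (1 / real (group.ord \<Gamma> \<gamma>)))
           \<in> O(\<lambda>N::nat. real N powr (1 / (2 * real (group.ord \<Gamma> \<gamma>))))"
proof -
  have groups: "group (G i)" if "i \<in> {1..k}" for i
    using assms(2)[OF that] by (simp add: admissible_factor_def)
  interpret free_product_groups "{1..k}" G by (rule free_product_groups.intro) (rule groups)
  have group: "group \<Gamma>" unfolding assms(3) using groups by (rule group_free_product)
  interpret \<Gamma>: group \<Gamma> by (rule group)
  have fin: "finite (perm_reps (G i) N)" if "i \<in> {1..k}" for i N
    using assms(2)[OF that] by (rule admissible_factor_finite_perm_reps)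
  have fin_\<Gamma>: "finite (perm_reps \<Gamma> N)" for N
    unfolding assms(3) by (rule finite_perm_reps_free_product) (simp_all add: fin)
  obtain n :: nat where n: "n > 0" "\<gamma> [^]\<^bsub>\<Gamma>\<^esub> n = \<one>\<^bsub>\<Gamma>\<^esub>" using assms(5) by blast
  show ?thesis
  \<comment> \<open>The identity singles out no factor, and all factors may be infinite, so it is
    settled directly. A nontrivial torsion element forces its factor to be finite.\<close>
  proof (cases "\<gamma> = \<one>\<^bsub>\<Gamma>\<^esub>")
    case True
    have ord: "group.ord \<Gamma> \<gamma> = 1" using True by simp
    have "card (perm_reps \<Gamma> N) \<noteq> 0" for N
      using fin_\<Gamma>[of N] \<Gamma>.actions_nonempty by (simp add: perm_reps_eq_actions)
    then have "expected_fix \<Gamma> \<gamma> N = real N" for N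
      by (simp add: True expected_fix_eq_sum[OF group fin_\<Gamma>] \<Gamma>.fix_count_one perm_reps_eq_actions)
    then show ?thesis by (simp add: ord)
  next
    case False
    obtain g i x where g: "g \<in> carrier \<Gamma>" and i: "i \<in> {1..k}" and x: "x \<in> carrier (G i)"
      and conj: "\<gamma> \<otimes>\<^bsub>\<Gamma>\<^esub> g = g \<otimes>\<^bsub>\<Gamma>\<^esub> letter_class {1..k} G i x"
      using torsion_conjugate_into_factor[of \<gamma> n] assms(4) False n unfolding assms(3) by blast
    let ?\<delta> = "letter_class {1..k} G i x"
    interpret Gi: group "G i" using groups[OF i] .
    have \<delta>: "?\<delta> \<in> carrier \<Gamma>" unfolding assms(3) by (rule hom_in_carrier[OF letter_class_hom[OF i] x])
    have pow: "\<gamma> [^]\<^bsub>\<Gamma>\<^esub> m = \<one>\<^bsub>\<Gamma>\<^esub> \<longleftrightarrow> x [^]\<^bsub>G i\<^esub> m = \<one>\<^bsub>G i\<^esub>" for m :: nat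
      using \<Gamma>.pow_eq_one_iff_intertwined[OF assms(4) \<delta> g conj, of m]
        letter_class_pow_eq_one_iff[OF i x, of m] by (simp add: assms(3))
    \<comment> \<open>An order is determined by which powers are trivial, and by \<open>pow\<close>
      these agree.\<close>
    have ord: "\<Gamma>.ord \<gamma> = Gi.ord x"
      using assms(4) x by (simp add: \<Gamma>.ord_unique pow Gi.pow_eq_id)
    have "x \<noteq> \<one>\<^bsub>G i\<^esub>" using pow[of 1] False assms(4) x by simp
    then have "finite (carrier (G i))"
      using admissible_factor_finite_or_torsion_free[OF assms(2)[OF i] n(1) x] n(2) pow by blast
    then interpret finite_group "G i" by unfold_locales
    have "expected_fix \<Gamma> \<gamma> N = expected_fix (G i) x N" for N
    proof -
      have "expected_fix \<Gamma> \<gamma> N = expected_fix \<Gamma> ?\<delta> N"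
        using fix_count_conjugate[OF group _ assms(4) \<delta> g conj]
        by (simp add: expected_fix_eq_sum[OF group fin_\<Gamma>])
      also have "\<dots> = expected_fix (G i) x N"
        unfolding assms(3) by (rule expected_fix_letter_class[OF _ fin i x]) simp_all
      finally show ?thesis .
    qed
    then show ?thesis using expected_fix_asymptotics[OF x] by (simp add: ord)
  qed
qed

end
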